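(* Let $G=\{N\in U(2m,\mathbb{F}_q) : N^TYN=Y\}$ be the Sylow $p$-subgroup of $Sp(2m,q)$ consisting of its lower unitriangular matrices. For $k\ge1$ let $h_k=\sum_{i=1}^m\left(x_{2m-i+1}^{q^k}x_i-x_{2m-i+1}x_i^{q^k}\right)$. Then the invariant field $\mathbb{F}_q(V)^G$ is generated by the polynomials $N(x_i)$, $i=1,\dots,m+1$, and $h_k$, $k=1,\dots,m-1$; i.e. $$\mathbb{F}_q(V)^G=\mathbb{F}_q(x_1,N(x_2),\dots,N(x_{m+1}),h_1,\dots,h_{m-1}).$$
   Context: $q$ is a power of a prime $p$, $m\ge 1$, $V=\mathbb{F}_q^{2m}$ (column vectors) with $x_1,\dots,x_{2m}$ the dual basis of the standard basis; $\mathbb{F}_q[V]=\mathbb{F}_q[x_1,\dots,x_{2m}]$, $\mathbb{F}_q(V)$ is its fraction field, and $G$ acts by $(g\cdot f)(v)=f(g^{-1}v)$. $N(x_i)=\prod_{y\in G\cdot x_i}y$ is the product over the $G$-orbit of $x_i$ (so $N(x_1)=x_1$). $U(n,\mathbb{F})$ is the group of lower triangular $n\times n$ matrices over $\mathbb{F}$ with ones on the diagonal. $J_k$ is the $k\times k$ matrix with ones on the antidiagonal and zeros elsewhere, and $$Y=\begin{pmatrix}0&0&J_{m-1}\\0&X_2&0\\-J_{m-1}&0&0\end{pmatrix},\quad X_2=\begin{pmatrix}0&1\\-1&0\end{pmatrix}$$ (blocks of size $0$ are omitted); $Sp(2m,q)=\{M\in GL_{2m}(\mathbb{F}_q):M^TYM=Y\}$.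 *)

theory Defs
  imports
    "Jordan_Normal_Form.Determinant"
    "HOL-Library.Poly_Mapping"
    "HOL-Computational_Algebra.Polynomial_Factorial"
    "HOL-Algebra.Generated_Fields"
    "HOL-Algebra.Algebraic_Closure_Type"
begin

section \<open>Polynomials and rational functions in n variables\<close>

text \<open>
  Polynomials are finitely supported maps from monomials to coefficients. The type has a variable
  for every natural number; the ring in the variables \<open>x\<^sub>1, \<dots>, x\<^sub>n\<close> and its field of fractions
  are the sets \<open>poly_ring n\<close> and \<open>rat_field n\<close> below.
\<close>

type_synonym 'a mpol = "(nat \<Rightarrow>\<^sub>0 nat) \<Rightarrow>\<^sub>0 'a"

definition Const :: "'a::comm_ring_1 \<Rightarrow> 'a mpol" where
  "Const c = Poly_Mapping.single 0 c"

definition Var :: "nat \<Rightarrow> 'a::comm_ring_1 mpol" where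
  "Var i = Poly_Mapping.single (Poly_Mapping.single i 1) 1"

definition poly_ring :: "nat \<Rightarrow> 'a::comm_ring_1 mpol set" where
  "poly_ring n = {f. \<forall>t\<in>Poly_Mapping.keys f. Poly_Mapping.keys t \<subseteq> {1..n}}"

definition rat_field :: "nat \<Rightarrow> 'a::field mpol fract set" where
  "rat_field n = {Fract a b |a b. a \<in> poly_ring n \<and> b \<in> poly_ring n \<and> b \<noteq> 0}"

definition mon_subst :: "(nat \<Rightarrow> 'a::comm_ring_1 mpol) \<Rightarrow> (nat \<Rightarrow>\<^sub>0 nat) \<Rightarrow> 'a mpol" where
  "mon_subst \<sigma> t = (\<Prod>i\<in>Poly_Mapping.keys t. \<sigma> i ^ Poly_Mapping.lookup t i)"

definition subst :: "(nat \<Rightarrow> 'a::comm_ring_1 mpol) \<Rightarrow> 'a mpol \<Rightarrow> 'a mpol" where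
  "subst \<sigma> f = (\<Sum>t\<in>Poly_Mapping.keys f. Const (Poly_Mapping.lookup f t) * mon_subst \<sigma> t)"

lemma Const_simps [simp]:
  "Const 0 = 0" "Const 1 = 1" "Const (a + b) = Const a + Const b" "Const (a * b) = Const a * Const b"
  by (simp_all add: Const_def single_add mult_single)

lemma Const_sum: "Const (sum f A) = (\<Sum>x\<in>A. Const (f x))"
  by (induction A rule: infinite_finite_induct) auto

lemma mpol_expand:
  "f = (\<Sum>t\<in>Poly_Mapping.keys f. Poly_Mapping.single t (Poly_Mapping.lookup f t))"
  by (rule poly_mapping_eqI)
    (auto simp: lookup_sum lookup_single when_def in_keys_iff sum.delta)

lemma mon_subst_superset:
  assumes "finite A" "Poly_Mapping.keys t \<subseteq> A"
  shows "mon_subst \<sigma> t = (\<Prod>i\<in>A. \<sigma> i ^ Poly_Mapping.lookup t i)"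
  unfolding mon_subst_def using assms by (intro prod.mono_neutral_left) (auto simp: in_keys_iff)

lemma mon_subst_0 [simp]: "mon_subst \<sigma> 0 = 1"
  by (simp add: mon_subst_def)

lemma mon_subst_add: "mon_subst \<sigma> (s + t) = mon_subst \<sigma> s * mon_subst \<sigma> t"
proof -
  let ?A = "Poly_Mapping.keys s \<union> Poly_Mapping.keys t"
  have "mon_subst \<sigma> (s + t) = (\<Prod>i\<in>?A. \<sigma> i ^ Poly_Mapping.lookup (s + t) i)"
    by (rule mon_subst_superset) (auto simp: Poly_Mapping.keys_add)
  also have "\<dots> = (\<Prod>i\<in>?A. \<sigma> i ^ Poly_Mapping.lookup s i) * (\<Prod>i\<in>?A. \<sigma> i ^ Poly_Mapping.lookup t i)"
    by (simp add: lookup_add power_add prod.distrib)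
  finally show ?thesis by (simp add: mon_subst_superset[of ?A])
qed

lemma subst_superset:
  assumes "finite A" "Poly_Mapping.keys f \<subseteq> A"
  shows "subst \<sigma> f = (\<Sum>t\<in>A. Const (Poly_Mapping.lookup f t) * mon_subst \<sigma> t)"
  unfolding subst_def using assms by (intro sum.mono_neutral_left) (auto simp: in_keys_iff)

lemma subst_0 [simp]: "subst \<sigma> 0 = 0"
  by (simp add: subst_def)

lemma subst_add: "subst \<sigma> (f + g) = subst \<sigma> f + subst \<sigma> g"
proof -
  let ?A = "Poly_Mapping.keys f \<union> Poly_Mapping.keys g"
  have "subst \<sigma> (f + g) = (\<Sum>t\<in>?A. Const (Poly_Mapping.lookup (f + g) t) * mon_subst \<sigma> t)"
    by (rule subst_superset) (auto simp: Poly_Mapping.keys_add)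
  then show ?thesis
    by (simp add: lookup_add algebra_simps sum.distrib subst_superset[of ?A])
qed

lemma subst_sum: "subst \<sigma> (sum f A) = (\<Sum>x\<in>A. subst \<sigma> (f x))"
  by (induction A rule: infinite_finite_induct) (auto simp: subst_add)

lemma subst_single: "subst \<sigma> (Poly_Mapping.single t c) = Const c * mon_subst \<sigma> t"
  by (cases "c = 0") (auto simp: subst_def)

lemma subst_mult: "subst \<sigma> (f * g) = subst \<sigma> f * subst \<sigma> g"
proof -
  let ?S = "\<lambda>h. \<Sum>t\<in>Poly_Mapping.keys h. Poly_Mapping.single t (Poly_Mapping.lookup h t)"
  have "subst \<sigma> (f * g) = subst \<sigma> (?S f * ?S g)"
    using mpol_expand[of f] mpol_expand[of g] by simp
  also have "\<dots> = subst \<sigma> (?S f) * subst \<sigma> (?S g)"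
    by (simp add: sum_product subst_sum mult_single subst_single mon_subst_add mult_ac)
  finally show ?thesis using mpol_expand[of f] mpol_expand[of g] by simp
qed

lemma subst_Const [simp]: "subst \<sigma> (Const c) = Const c"
  by (simp add: Const_def subst_single[unfolded Const_def])

lemma subst_Var [simp]: "subst \<sigma> (Var i) = \<sigma> i"
  by (simp add: Var_def subst_single mon_subst_def)

lemma subst_power: "subst \<sigma> (f ^ k) = subst \<sigma> f ^ k"
  using subst_Const[of \<sigma> 1] by (induction k) (simp_all add: subst_mult)

lemma subst_prod: "subst \<sigma> (prod f A) = (\<Prod>x\<in>A. subst \<sigma> (f x))"
  using subst_Const[of \<sigma> 1]
  by (induction A rule: infinite_finite_induct) (simp_all add: subst_mult)

lemma subst_subst: "subst \<sigma> (subst \<tau> f) = subst (\<lambda>i. subst \<sigma> (\<tau> i)) f"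
  by (simp add: subst_def[of \<tau>] subst_def[of "\<lambda>i. subst \<sigma> (\<tau> i)"] subst_sum subst_mult
      mon_subst_def subst_prod subst_power)

lemma Var_power: "Var i ^ k = Poly_Mapping.single (Poly_Mapping.single i k) 1"
  by (induction k) (simp_all add: Var_def mult_single flip: single_add)

lemma mon_subst_Var: "mon_subst Var t = Poly_Mapping.single t 1"
proof -
  have "(\<Prod>i\<in>A. Poly_Mapping.single (h i) 1) = (Poly_Mapping.single (sum h A) 1 :: 'a mpol)"
    for A :: "nat set" and h
    by (induction A rule: infinite_finite_induct) (auto simp: mult_single)
  moreover have "t = (\<Sum>i\<in>Poly_Mapping.keys t. Poly_Mapping.single i (Poly_Mapping.lookup t i))"
    by (rule poly_mapping_eqI)
      (auto simp: lookup_sum lookup_single when_def in_keys_iff sum.delta)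
  ultimately show ?thesis by (simp add: mon_subst_def Var_power)
qed

lemma subst_Var_id [simp]: "subst Var f = f"
  using mpol_expand[of f] by (simp add: subst_def mon_subst_Var Const_def mult_single)


section \<open>The action of the general linear group\<close>

abbreviation GL :: "nat \<Rightarrow> 'a::field mat set" where
  "GL n \<equiv> Units (ring_mat TYPE('a) n ())"

text \<open>
  As \<open>(g \<cdot> x\<^sub>i)(v) = x\<^sub>i(g\<inverse> v)\<close>, the element \<open>g\<close> sends \<open>x\<^sub>i\<close> to the sum of the \<open>(g\<inverse>)\<^sub>i\<^sub>j x\<^sub>j\<close>. Matrix
  entries are numbered from 0, variables from 1. Variables outside \<open>x\<^sub>1, \<dots>, x\<^sub>n\<close> are fixed.
\<close>

definition lin_subst :: "nat \<Rightarrow> 'a::field mat \<Rightarrow> nat \<Rightarrow> 'a mpol" where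
  "lin_subst n A i =
     (if i \<in> {1..n} then \<Sum>j=1..n. Const (A $$ (i - 1, j - 1)) * Var j else Var i)"

definition act :: "nat \<Rightarrow> 'a::field mat \<Rightarrow> 'a mpol \<Rightarrow> 'a mpol" where
  "act n g f = subst (lin_subst n (inv\<^bsub>ring_mat TYPE('a) n ()\<^esub> g)) f"

text \<open>Well defined for invertible \<open>g\<close>: see \<open>act_fract_Fract\<close>.\<close>

definition act_fract :: "nat \<Rightarrow> 'a::field mat \<Rightarrow> 'a mpol fract \<Rightarrow> 'a mpol fract" where
  "act_fract n g r = (THE s. \<exists>a b. b \<noteq> 0 \<and> r = Fract a b \<and> s = Fract (act n g a) (act n g b))"

lemma subst_lin_subst:
  assumes "A \<in> carrier_mat n n" "B \<in> carrier_mat n n"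
  shows "subst (lin_subst n A) (subst (lin_subst n B) f) = subst (lin_subst n (B * A)) f"
proof -
  have "subst (lin_subst n A) (lin_subst n B i) = lin_subst n (B * A) i" for i
  proof (cases "i \<in> {1..n}")
    case True
    have "(\<Sum>k=1..n. B $$ (i - 1, k - 1) * A $$ (k - 1, j - 1)) = (B * A) $$ (i - 1, j - 1)"
      if "j \<in> {1..n}" for j
    proof -
      have "(B * A) $$ (i - 1, j - 1) = (\<Sum>k=0..<n. B $$ (i - 1, k) * A $$ (k, j - 1))"
        using assms True that by (auto simp: scalar_prod_def)
      also have "\<dots> = (\<Sum>k=1..n. B $$ (i - 1, k - 1) * A $$ (k - 1, j - 1))"
        by (rule sum.reindex_bij_witness[of _ "\<lambda>k. k - 1" Suc]) auto
      finally show ?thesis by simp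
    qed
    note entry = this
    have "subst (lin_subst n A) (lin_subst n B i) =
        (\<Sum>k=1..n. \<Sum>j=1..n. Const (B $$ (i - 1, k - 1) * A $$ (k - 1, j - 1)) * Var j)"
      using True by (simp add: lin_subst_def[of n B] subst_sum subst_mult)
        (simp add: lin_subst_def sum_distrib_left mult.assoc)
    also have "\<dots> = (\<Sum>j=1..n. Const (\<Sum>k=1..n. B $$ (i - 1, k - 1) * A $$ (k - 1, j - 1)) * Var j)"
      by (subst sum.swap) (simp add: Const_sum sum_distrib_right)
    also have "\<dots> = lin_subst n (B * A) i"
      using True entry by (simp add: lin_subst_def del: Const_simps)
    finally show ?thesis .
  qed (auto simp: lin_subst_def)
  then show ?thesis by (simp add: subst_subst)
qed

lemma subst_lin_subst_one [simp]:
  fixes f :: "'a::field mpol"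
  shows "subst (lin_subst n (1\<^sub>m n)) f = f"
proof -
  have "lin_subst n (1\<^sub>m n) i = (Var i :: 'a mpol)" for i
  proof (cases "i \<in> {1..n}")
    case True
    have "(lin_subst n (1\<^sub>m n) i :: 'a mpol) = (\<Sum>j=1..n. if i = j then Var j else 0 :: 'a mpol)"
      unfolding lin_subst_def if_P[OF True]
    proof (rule sum.cong)
      fix j assume "j \<in> {1..n}"
      with True have "i - 1 < n" "j - 1 < n" "i - 1 = j - 1 \<longleftrightarrow> i = j" by auto
      then show "Const (1\<^sub>m n $$ (i - 1, j - 1)) * Var j = (if i = j then Var j else 0 :: 'a mpol)"
        by simp
    qed simp
    then show ?thesis using True by simp
  qed (auto simp: lin_subst_def)
  then have "lin_subst n (1\<^sub>m n :: 'a mat) = Var" by blast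
  then show ?thesis by simp
qed

lemma act_inj:
  fixes g :: "'a::field mat"
  assumes "g \<in> GL n" "act n g f = act n g f'"
  shows "f = f'"
proof -
  interpret ring "ring_mat TYPE('a) n ()" by (rule ring_mat)
  have "g \<in> carrier_mat n n" "inv\<^bsub>ring_mat TYPE('a) n ()\<^esub> g \<in> carrier_mat n n"
    "inv\<^bsub>ring_mat TYPE('a) n ()\<^esub> g * g = 1\<^sub>m n"
    using assms(1) Units_closed Units_inv_closed Units_l_inv by (auto simp: ring_mat_simps)
  then have "subst (lin_subst n g) (act n g h) = h" for h
    by (simp add: act_def subst_lin_subst)
  then show ?thesis using assms(2) by metis
qed

lemma act_fract_Fract:
  assumes "g \<in> GL n" "b \<noteq> 0"
  shows "act_fract n g (Fract a b) = Fract (act n g a) (act n g b)"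
proof -
  have nz: "act n g d \<noteq> 0" if "d \<noteq> 0" for d
    using act_inj[OF assms(1), of d 0] that by (auto simp: act_def)
  have "Fract (act n g a') (act n g b') = Fract (act n g a) (act n g b)"
    if "b' \<noteq> 0" "Fract a b = Fract a' b'" for a' b'
  proof -
    have "a * b' = a' * b" using that assms(2) by (simp add: eq_fract)
    then have "act n g a * act n g b' = act n g a' * act n g b"
      by (simp add: act_def flip: subst_mult)
    then show ?thesis using nz that(1) assms(2) by (simp add: eq_fract)
  qed
  then show ?thesis unfolding act_fract_def using assms(2) by (intro the_equality) blast+
qed

definition invariant_field :: "nat \<Rightarrow> 'a::field mat set \<Rightarrow> 'a mpol fract set" where
  "invariant_field n G = {r \<in> rat_field n. \<forall>g\<in>G. act_fract n g r = r}"

definition orbit_prod :: "nat \<Rightarrow> 'a::field mat set \<Rightarrow> nat \<Rightarrow> 'a mpol" where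
  "orbit_prod n G i = (\<Prod>y\<in>(\<lambda>g. act n g (Var i)) ` G. y)"

text \<open>The subfield of the field of rational functions generated by the constants and \<open>S\<close>.\<close>

definition adjoin :: "'a::field mpol fract set \<Rightarrow> 'a mpol fract set" where
  "adjoin S = generate_field ring_of_type_algebra (range (\<lambda>c. to_fract (Const c)) \<union> S)"


section \<open>The symplectic group and its lower unitriangular subgroup\<close>

definition lower_unitriangular :: "nat \<Rightarrow> 'a::field mat set" where
  "lower_unitriangular n =
     {A \<in> carrier_mat n n. (\<forall>i<n. A $$ (i, i) = 1) \<and> (\<forall>i<n. \<forall>j<n. i < j \<longrightarrow> A $$ (i, j) = 0)}"

definition antidiag :: "nat \<Rightarrow> 'a::field mat" where
  "antidiag k = mat k k (\<lambda>(i, j). if i + j + 1 = k then 1 else 0)"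

definition X2 :: "'a::field mat" where
  "X2 = mat_of_rows_list 2 [[0, 1], [-1, 0]]"

text \<open>
  The 3 by 3 block matrix with rows \<open>(0, 0, J)\<close>, \<open>(0, X2, 0)\<close>, \<open>(-J, 0, 0)\<close>, its first two block
  rows and columns being grouped together. In the lower left group \<open>(-J, 0)\<close> the last two blocks
  have no rows.
\<close>

definition symp_form :: "nat \<Rightarrow> 'a::field mat" where
  "symp_form m =
     four_block_mat
       (four_block_mat (0\<^sub>m (m-1) (m-1)) (0\<^sub>m (m-1) 2) (0\<^sub>m 2 (m-1)) X2)
       (antidiag (m-1) @\<^sub>r 0\<^sub>m 2 (m-1))
       (four_block_mat (- antidiag (m-1)) (0\<^sub>m (m-1) 2) (0\<^sub>m 0 (m-1)) (0\<^sub>m 0 2))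
       (0\<^sub>m (m-1) (m-1))"

definition Sp :: "nat \<Rightarrow> 'a::field mat set" where
  "Sp m = {M \<in> GL (2*m). M\<^sup>T * symp_form m * M = symp_form m}"

definition sylow_Sp :: "nat \<Rightarrow> 'a::field mat set" where
  "sylow_Sp m = {N \<in> lower_unitriangular (2*m). N\<^sup>T * symp_form m * N = symp_form m}"

lemma lower_unitriangular_GL: "lower_unitriangular n \<subseteq> GL n"
proof
  fix A :: "'a mat" assume A: "A \<in> lower_unitriangular n"
  then have "det A = prod_list (diag_mat A)"
    by (intro det_lower_triangular[of n]) (auto simp: lower_unitriangular_def)
  also have "\<dots> = 1"
  proof -
    have "diag_mat A = map (\<lambda>_. 1) [0..<n]"
      using A by (auto simp: diag_mat_def lower_unitriangular_def)
    then show ?thesis by (simp add: map_replicate_const)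
  qed
  finally show "A \<in> GL n"
    using A by (intro det_non_zero_imp_unit) (auto simp: lower_unitriangular_def)
qed

lemma sylow_Sp_eq: "sylow_Sp m = lower_unitriangular (2*m) \<inter> Sp m"
  using lower_unitriangular_GL by (auto simp: sylow_Sp_def Sp_def)

definition h_poly :: "nat \<Rightarrow> nat \<Rightarrow> nat \<Rightarrow> 'a::field mpol" where
  "h_poly m q k = (\<Sum>i=1..m. Var (2*m - i + 1) ^ q ^ k * Var i - Var (2*m - i + 1) * Var i ^ q ^ k)"

end

theory Submission
  imports Defs
begin

text \<open>
  Adjoin \<open>x\<^sub>1, \<dots>, x\<^sub>2\<^sub>m\<close> one at a time to the field \<open>K\<close> of the generators. If \<open>x\<^sub>i\<close> is a root of a polynomial of
  degree \<open>d\<close> over \<open>K(x\<^sub>1, \<dots>, x\<^sub>i\<^sub>-\<^sub>1)\<close> and the stabilizer of \<open>x\<^sub>1, \<dots>, x\<^sub>i\<^sub>-\<^sub>1\<close> moves \<open>x\<^sub>i\<close> to at least \<open>d\<close> places,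
  then every invariant in \<open>K(x\<^sub>1, \<dots>, x\<^sub>i)\<close> already lies in \<open>K(x\<^sub>1, \<dots>, x\<^sub>i\<^sub>-\<^sub>1)\<close>; so the invariants descend from
  \<open>K(x\<^sub>1, \<dots>, x\<^sub>2\<^sub>m)\<close> to \<open>K\<close>. For \<open>i \<le> m + 1\<close> the polynomial comes from \<open>N(x\<^sub>i)\<close>, with \<open>d = q ^ (i-1)\<close>. For larger \<open>i\<close>
  put \<open>n = 2m + 1 - i\<close>, the index of the variable paired with \<open>x\<^sub>i\<close>: eliminating \<open>x\<^sub>i\<^sub>+\<^sub>1, \<dots>, x\<^sub>2\<^sub>m\<close> from the Frobenius
  powers of \<open>h\<^sub>1, \<dots>, h\<^sub>n\<close> by means of the additive polynomial that vanishes on \<open>x\<^sub>1, \<dots>, x\<^sub>n\<^sub>-\<^sub>1\<close> leaves an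
  equation of degree \<open>d = q ^ n\<close> for \<open>x\<^sub>i\<close>.
\<close>

section \<open>Fields generated by one element over a subfield\<close>

text \<open>A subfield as a bare set inside a field type, so that the type class polynomials apply
  to it directly. As \<open>inverse 0 = 0\<close>, closure under \<open>inverse\<close> needs no
  side condition.\<close>

locale type_subfield =
  fixes K :: "'l::field set"
  assumes zero [simp, intro]: "0 \<in> K" and one [simp, intro]: "1 \<in> K"
    and add [intro]: "x \<in> K \<Longrightarrow> y \<in> K \<Longrightarrow> x + y \<in> K"
    and mult [intro]: "x \<in> K \<Longrightarrow> y \<in> K \<Longrightarrow> x * y \<in> K"
    and uminus [intro]: "x \<in> K \<Longrightarrow> - x \<in> K"
    and inverse [intro]: "x \<in> K \<Longrightarrow> inverse x \<in> K"
begin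

lemma diff [intro]: "x \<in> K \<Longrightarrow> y \<in> K \<Longrightarrow> x - y \<in> K"
  using add[of x "- y"] uminus[of y] by simp

lemma divide [intro]: "x \<in> K \<Longrightarrow> y \<in> K \<Longrightarrow> x / y \<in> K"
  by (auto simp: divide_inverse)

lemma power [intro]: "x \<in> K \<Longrightarrow> x ^ n \<in> K"
  by (induction n) auto

lemma sum [intro]: "(\<And>i. i \<in> A \<Longrightarrow> f i \<in> K) \<Longrightarrow> sum f A \<in> K"
  by (induction A rule: infinite_finite_induct) auto

lemma prod [intro]: "(\<And>i. i \<in> A \<Longrightarrow> f i \<in> K) \<Longrightarrow> prod f A \<in> K"
  by (induction A rule: infinite_finite_induct) auto

definition polys :: "'l poly set" where
  "polys = {p. \<forall>i. Polynomial.coeff p i \<in> K}"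

lemma coeff_polys [intro]: "p \<in> polys \<Longrightarrow> Polynomial.coeff p i \<in> K"
  by (simp add: polys_def)

lemma polys_pCons [intro]: "c \<in> K \<Longrightarrow> p \<in> polys \<Longrightarrow> pCons c p \<in> polys"
  by (auto simp: polys_def coeff_pCons split: nat.split)

lemma polys_0 [simp, intro]: "0 \<in> polys"
  by (simp add: polys_def)

lemma polys_1 [simp, intro]: "1 \<in> polys"
  by (simp add: one_pCons polys_pCons)

lemma polys_add [intro]: "p \<in> polys \<Longrightarrow> r \<in> polys \<Longrightarrow> p + r \<in> polys"
  by (auto simp: polys_def)

lemma polys_diff [intro]: "p \<in> polys \<Longrightarrow> r \<in> polys \<Longrightarrow> p - r \<in> polys"
  by (auto simp: polys_def)

lemma polys_uminus [intro]: "p \<in> polys \<Longrightarrow> - p \<in> polys"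
  by (auto simp: polys_def)

lemma polys_mult [intro]: "p \<in> polys \<Longrightarrow> r \<in> polys \<Longrightarrow> p * r \<in> polys"
  by (auto simp: polys_def coeff_mult)

lemma polys_smult [intro]: "c \<in> K \<Longrightarrow> p \<in> polys \<Longrightarrow> Polynomial.smult c p \<in> polys"
  by (auto simp: polys_def)

lemma polys_monom [intro]: "c \<in> K \<Longrightarrow> Polynomial.monom c n \<in> polys"
  by (auto simp: polys_def)

lemma polys_power [intro]: "p \<in> polys \<Longrightarrow> p ^ n \<in> polys"
  by (induction n) auto

lemma polys_sum [intro]: "(\<And>i. i \<in> A \<Longrightarrow> f i \<in> polys) \<Longrightarrow> sum f A \<in> polys"
  by (induction A rule: infinite_finite_induct) auto

lemma polys_prod [intro]: "(\<And>i. i \<in> A \<Longrightarrow> f i \<in> polys) \<Longrightarrow> prod f A \<in> polys"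
  by (induction A rule: infinite_finite_induct) auto

text \<open>The fractions form \<open>K(x)\<close>, whether or not \<open>x\<close> is algebraic
  over \<open>K\<close>. This bounds the next field of the tower from above.\<close>

lemma simple_extension:
  "type_subfield {poly a x / poly b x |a b. a \<in> polys \<and> b \<in> polys \<and> poly b x \<noteq> 0}"
    (is "type_subfield ?E")
proof
  have E: "poly a x / poly b x \<in> ?E" if "a \<in> polys" "b \<in> polys" "poly b x \<noteq> 0" for a b
    using that by blast
  show "0 \<in> ?E" "1 \<in> ?E" using E[of 0 1] E[of 1 1] by auto
  show "- u \<in> ?E" "inverse u \<in> ?E" if u: "u \<in> ?E" for u
  proof -
    obtain a b where ab: "a \<in> polys" "b \<in> polys" "poly b x \<noteq> 0" "u = poly a x / poly b x"
      using u by blast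
    show "- u \<in> ?E" using E[of "- a" b] ab by auto
    \<comment> \<open>If the numerator vanishes at \<open>x\<close>, then \<open>u = 0\<close> and
      its inverse is written as \<open>0 / 1\<close>.\<close>
    show "inverse u \<in> ?E" using E[of b a] E[of 0 1] ab by (cases "poly a x = 0") auto
  qed
  show "u + v \<in> ?E" "u * v \<in> ?E" if u: "u \<in> ?E" and v: "v \<in> ?E" for u v
  proof -
    obtain a b where ab: "a \<in> polys" "b \<in> polys" "poly b x \<noteq> 0" "u = poly a x / poly b x"
      using u by blast
    obtain c d where cd: "c \<in> polys" "d \<in> polys" "poly d x \<noteq> 0" "v = poly c x / poly d x"
      using v by blast
    show "u * v \<in> ?E" using E[of "a * c" "b * d"] ab cd by auto
    have "u + v = poly (a * d + c * b) x / poly (b * d) x"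
      using ab cd by (simp add: add_frac_eq)
    then show "u + v \<in> ?E" using E[of "a * d + c * b" "b * d"] ab cd by auto
  qed
qed

text \<open>Division with remainder, one leading term at a time: subtracting a multiple of
  \<open>p\<close> keeps the value at \<open>x\<close>. Quotients of leading coefficients stay in
  \<open>K\<close>, so \<open>p\<close> may be non-monic.\<close>

lemma reduce_poly:
  assumes p: "p \<in> polys" "Polynomial.degree p > 0" "poly p x = 0" and "a \<in> polys"
  shows "\<exists>r\<in>polys. Polynomial.degree r < Polynomial.degree p \<and> poly r x = poly a x"
  using \<open>a \<in> polys\<close>
proof (induction "Polynomial.degree a" arbitrary: a rule: less_induct)
  case less
  show ?case
  proof (cases "Polynomial.degree a < Polynomial.degree p")
    case False
    define t where "t = Polynomial.monom (Polynomial.lead_coeff a / Polynomial.lead_coeff p)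
      (Polynomial.degree a - Polynomial.degree p) * p"
    have nz: "Polynomial.lead_coeff p \<noteq> 0" "Polynomial.lead_coeff a \<noteq> 0" using p(2) False by auto
    have t: "Polynomial.degree t = Polynomial.degree a"
      using nz False by (auto simp: t_def degree_mult_eq degree_monom_eq)
    have lc: "Polynomial.lead_coeff t = Polynomial.lead_coeff a"
      unfolding t_def lead_coeff_mult using nz by (simp add: degree_monom_eq)
    have "Polynomial.coeff (a - t) i = 0" if "i \<ge> Polynomial.degree a" for i
      using that t lc coeff_eq_0[of a i] coeff_eq_0[of t i] by (cases "i = Polynomial.degree a") auto
    then have "Polynomial.degree a \<le> Polynomial.degree (a - t) \<Longrightarrow> a - t = 0"
      using leading_coeff_0_iff[of "a - t"] by blast
    moreover have "Polynomial.degree a > 0"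
      using p(2) False by simp
    ultimately have "Polynomial.degree (a - t) < Polynomial.degree a"
      by (metis degree_0 not_le)
    moreover have "a - t \<in> polys"
      unfolding t_def using less.prems p(1)
      by (intro polys_diff polys_mult polys_monom divide coeff_polys)
    ultimately have "\<exists>r\<in>polys. Polynomial.degree r < Polynomial.degree p \<and> poly r x = poly (a - t) x"
      by (intro less.hyps)
    then show ?thesis by (simp add: t_def p(3))
  qed (use less.prems in blast)
qed

text \<open>
  Writing \<open>f = a(x) / b(x)\<close> with \<open>deg a, deg b < deg p\<close>, the polynomial \<open>f b - a\<close> has the
  roots \<open>\<sigma> x\<close>, hence vanishes, and \<open>f\<close> is a quotient of coefficients of \<open>a\<close> and \<open>b\<close>.
\<close>

lemma fixed_element_descent:
  assumes p: "p \<in> polys" "p \<noteq> 0" "poly p x = 0"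
    and S: "finite S" "Polynomial.degree p \<le> card S"
    and f: "f \<in> {poly a x / poly b x |a b. a \<in> polys \<and> b \<in> polys \<and> poly b x \<noteq> 0}"
    and \<sigma>: "\<And>s. s \<in> S \<Longrightarrow> \<exists>\<sigma>. (\<forall>u v. \<sigma> (u + v) = \<sigma> u + \<sigma> v) \<and> (\<forall>u v. \<sigma> (u * v) = \<sigma> u * \<sigma> v)
        \<and> (\<forall>c\<in>K. \<sigma> c = c) \<and> \<sigma> f = f \<and> \<sigma> x = s"
  shows "f \<in> K"
proof -
  obtain a b where ab: "a \<in> polys" "b \<in> polys" "poly b x \<noteq> 0" "f = poly a x / poly b x"
    using f by blast
  have deg: "Polynomial.degree p > 0"
  proof (rule ccontr)
    assume "\<not> ?thesis"
    then obtain c where "p = [:c:]" by (meson degree_eq_zeroE neq0_conv)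
    with p(2,3) show False by simp
  qed
  obtain a' where a': "a' \<in> polys" "Polynomial.degree a' < Polynomial.degree p" "poly a' x = poly a x"
    using reduce_poly[OF p(1) deg p(3) ab(1)] by blast
  obtain b' where b': "b' \<in> polys" "Polynomial.degree b' < Polynomial.degree p" "poly b' x = poly b x"
    using reduce_poly[OF p(1) deg p(3) ab(2)] by blast
  define r where "r = Polynomial.smult f b' - a'"
  have "poly r s = 0" if s: "s \<in> S" for s
  proof -
    obtain \<sigma> where add: "\<And>u v. \<sigma> (u + v) = \<sigma> u + \<sigma> v" and mult: "\<And>u v. \<sigma> (u * v) = \<sigma> u * \<sigma> v"
      and fixed: "\<And>c. c \<in> K \<Longrightarrow> \<sigma> c = c" "\<sigma> f = f" "\<sigma> x = s"
      using \<sigma>[OF s] by blast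
    \<comment> \<open>The map \<open>\<sigma>\<close> fixes the coefficients, so it only moves the
      point of evaluation.\<close>
    have "\<sigma> (poly c x) = poly c s" if "c \<in> polys" for c
      using that
    proof (induction c)
      case (pCons k c)
      have "Polynomial.coeff (pCons k c) i \<in> K" for i
        using pCons.prems by blast
      from this[of 0] this[of "Suc _"] have "k \<in> K" "c \<in> polys"
        by (auto simp: polys_def)
      then show ?case using pCons.IH by (simp add: add mult fixed)
    qed (simp add: fixed)
    moreover have "f * poly b' x = poly a' x"
      using ab a' b' by simp
    then have "f * \<sigma> (poly b' x) = \<sigma> (poly a' x)"
      by (metis mult fixed(2))
    ultimately have "f * poly b' s = poly a' s" using a'(1) b'(1) by simp
    then show ?thesis by (simp add: r_def)
  qed
  then have "S \<subseteq> {s. poly r s = 0}" by blast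
  moreover have "Polynomial.degree r < card S"
    unfolding r_def using a'(2) b'(2) S(2) degree_smult_le[of f b']
    by (intro less_le_trans[OF degree_diff_less S(2)]) auto
  ultimately have "r = 0"
    using card_poly_roots_bound[of r] poly_roots_finite[of r] card_mono[of "{s. poly r s = 0}" S]
    by fastforce
  have "b' \<noteq> 0" using b'(3) ab(3) by auto
  then have "Polynomial.lead_coeff b' \<noteq> 0" by simp
  moreover have "f * Polynomial.lead_coeff b' = Polynomial.coeff a' (Polynomial.degree b')"
    using \<open>r = 0\<close> unfolding r_def by (metis coeff_smult eq_iff_diff_eq_0)
  ultimately have "f = Polynomial.coeff a' (Polynomial.degree b') / Polynomial.lead_coeff b'"
    by (simp add: field_simps)
  then show ?thesis using a'(1) b'(1) by auto
qed

section \<open>Additive polynomials and the Frobenius map\<close>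

text \<open>From \<open>P\<close> vanishing on the first \<open>n\<close> elements, pass to
  \<open>P ^ q - c ^ (q - 1) * P\<close> with \<open>c = P (x (Suc n))\<close>. It still vanishes
  where \<open>P\<close> does, and at \<open>x (Suc n)\<close> as
  \<open>c ^ q = c ^ (q - 1) * c\<close>. By additivity of the \<open>q\<close>-th power it again
  has only exponents \<open>q ^ a\<close>.\<close>

lemma additive_poly_kernel:
  assumes frob: "\<And>a b :: 'l. (a + b) ^ q = a ^ q + b ^ q" "q > 0"
    and x: "\<And>j. j \<in> {1..n} \<Longrightarrow> x j \<in> K"
  shows "\<exists>l. (\<forall>a. l a \<in> K) \<and> l n = 1 \<and> (\<forall>j\<in>{1..n}. (\<Sum>a\<le>n. l a * x j ^ q ^ a) = 0)"
  using x
proof (induction n)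
  case 0
  show ?case by (intro exI[of _ "\<lambda>_. 1"]) auto
next
  case (Suc n)
  have pow_sum: "sum f A ^ q = (\<Sum>i\<in>A. f i ^ q)" for f :: "nat \<Rightarrow> 'l" and A
    using frob by (induction A rule: infinite_finite_induct) (auto simp: zero_power)
  obtain l where l: "\<And>a. l a \<in> K" "l n = 1"
      "\<And>j. j \<in> {1..n} \<Longrightarrow> (\<Sum>a\<le>n. l a * x j ^ q ^ a) = 0"
    using Suc by force
  define P where "P t = (\<Sum>a\<le>n. l a * t ^ q ^ a)" for t
  define c where "c = P (x (Suc n))"
  \<comment> \<open>The \<open>q\<close>-th power shifts the indices of \<open>l\<close> up by one:
    the first summand starts at \<open>a = 1\<close>, while the second stops at
    \<open>a = n\<close>.\<close>
  define l' where "l' a = (if a = 0 then 0 else l (a - 1) ^ q) - (if a \<le> n then c ^ (q - 1) * l a else 0)" for a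
  have c: "c \<in> K"
    unfolding c_def P_def by (intro sum mult power l(1) Suc.prems) simp
  have "(\<Sum>a\<le>Suc n. l' a * t ^ q ^ a) = P t ^ q - c ^ (q - 1) * P t" for t
  proof -
    have "(\<Sum>a\<le>Suc n. l' a * t ^ q ^ a) =
        (\<Sum>a\<le>Suc n. (if a = 0 then 0 else l (a - 1) ^ q) * t ^ q ^ a)
      - (\<Sum>a\<le>Suc n. (if a \<le> n then c ^ (q - 1) * l a else 0) * t ^ q ^ a)"
      by (simp add: l'_def algebra_simps sum_subtractf del: sum.atMost_Suc)
    also have "(\<Sum>a\<le>Suc n. (if a = 0 then 0 else l (a - 1) ^ q) * t ^ q ^ a) = P t ^ q"
      by (subst sum.atMost_Suc_shift)
        (simp add: P_def pow_sum power_mult_distrib power_mult[symmetric] mult.commute)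
    also have "(\<Sum>a\<le>Suc n. (if a \<le> n then c ^ (q - 1) * l a else 0) * t ^ q ^ a) = c ^ (q - 1) * P t"
      by (simp add: P_def sum_distrib_left mult.assoc)
    finally show ?thesis .
  qed
  moreover have "P t ^ q - c ^ (q - 1) * P t = 0" if "t = x (Suc n) \<or> P t = 0" for t
    using that frob(2) by (auto simp: c_def zero_power power_Suc2[symmetric] simp del: power_Suc)
  moreover have "P (x j) = 0" if "j \<in> {1..n}" for j
    using l(3)[OF that] by (simp add: P_def)
  ultimately have "(\<Sum>a\<le>Suc n. l' a * x j ^ q ^ a) = 0" if "j \<in> {1..Suc n}" for j
    using that frob(2) by (cases "j = Suc n") (auto simp: zero_power simp del: sum.atMost_Suc)
  moreover have "l' a \<in> K" for a
    using l(1) c by (auto simp: l'_def)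
  moreover have "l' (Suc n) = 1" by (simp add: l'_def l(2))
  ultimately show ?case by blast
qed

end

text \<open>
  \<open>(T + 1) ^ q - T ^ q - 1\<close> has degree less than \<open>q\<close> and vanishes on the \<open>q\<close> elements of \<open>F\<close>.
\<close>

lemma power_card_additive:
  fixes F :: "'l::field set"
  assumes F: "finite F" "card F = q" "q > 0" "\<And>c. c \<in> F \<Longrightarrow> c ^ q = c \<and> c + 1 \<in> F"
  shows "(a + b) ^ q = a ^ q + (b :: 'l) ^ q"
proof -
  define p :: "'l poly" where "p = [:1, 1:] ^ q - Polynomial.monom 1 q - 1"
  have d: "Polynomial.degree ([:1, 1:] ^ q :: 'l poly) = q" "Polynomial.coeff ([:1, 1:] ^ q :: 'l poly) q = 1"
    using degree_power_eq[of "[:1, 1:] :: 'l poly" q] lead_coeff_power[of "[:1, 1:] :: 'l poly" q] by auto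
  have "Polynomial.coeff p i = 0" if "i \<ge> q" for i
    using that d F(3) coeff_eq_0[of "[:1, 1:] ^ q :: 'l poly" i]
    by (cases "i = q") (auto simp: p_def)
  then have "p \<noteq> 0 \<Longrightarrow> Polynomial.degree p < q"
    by (metis leading_coeff_0_iff not_le)
  moreover have root: "poly p t = (t + 1) ^ q - t ^ q - 1" for t :: 'l
    by (simp add: p_def poly_monom add.commute)
  then have "F \<subseteq> {t. poly p t = 0}" using F(4) by auto
  ultimately have "p = 0"
    using card_poly_roots_bound[of p] poly_roots_finite[of p] card_mono[of "{s. poly p s = 0}" F] F(2)
    by fastforce
  then have *: "(t + 1) ^ q = t ^ q + 1" for t :: 'l
    using root[of t] by (simp add: algebra_simps)
  show ?thesis
  proof (cases "b = 0")
    case False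
    \<comment> \<open>Division by \<open>b\<close> reduces the claim to the case
      \<open>b = 1\<close> just proved.\<close>
    then have "(a + b) ^ q = b ^ q * (a / b + 1) ^ q"
      by (simp add: distrib_left flip: power_mult_distrib)
    also have "\<dots> = a ^ q + b ^ q"
      using False by (simp add: * power_divide distrib_left)
    finally show ?thesis .
  qed (use F(3) in \<open>simp add: zero_power\<close>)
qed

text \<open>Multiplication by a nonzero \<open>c\<close> permutes the nonzero elements; comparing
  the products of all of them shows that their number is an exponent killing
  \<open>c\<close>.\<close>

lemma finite_field_power_card:
  fixes c :: "'a::{field,finite}"
  shows "c ^ card (UNIV :: 'a set) = c"
proof (cases "c = 0")
  case False
  let ?U = "UNIV - {0 :: 'a}"
  have "(\<Prod>y\<in>?U. y) = (\<Prod>y\<in>?U. c * y)"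
    by (rule prod.reindex_bij_witness[of _ "\<lambda>y. c * y" "\<lambda>y. y / c"]) (use False in auto)
  also have "\<dots> = c ^ card ?U * (\<Prod>y\<in>?U. y)"
    by (simp add: prod.distrib)
  finally have "c ^ card ?U = 1" by simp
  then have "c * c ^ (card (UNIV :: 'a set) - 1) = c" by simp
  then show ?thesis
    by (metis Suc_diff_1 finite_UNIV_card_ge_0 finite_class.finite_UNIV power_Suc)
qed (simp add: finite_UNIV_card_ge_0 zero_power)

section \<open>Rational functions and the group action\<close>

text \<open>\<open>generate_field\<close> speaks of the operations of a ring record; these
  identities turn them into type class operations.\<close>

lemma ring_of_type_algebra_simps:
  fixes x y :: "'l::field"
  shows "\<zero>\<^bsub>ring_of_type_algebra\<^esub> = (0 :: 'l)" "\<one>\<^bsub>ring_of_type_algebra\<^esub> = (1 :: 'l)"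
    "x \<oplus>\<^bsub>ring_of_type_algebra\<^esub> y = x + y" "x \<otimes>\<^bsub>ring_of_type_algebra\<^esub> y = x * y"
    "\<ominus>\<^bsub>ring_of_type_algebra\<^esub> x = - x"
    "x \<noteq> 0 \<Longrightarrow> inv\<^bsub>ring_of_type_algebra\<^esub> x = inverse x"
proof -
  let ?R = "ring_of_type_algebra :: 'l ring"
  interpret cring ?R by (rule cring_from_type_algebra)
  show simps: "\<zero>\<^bsub>?R\<^esub> = 0" "\<one>\<^bsub>?R\<^esub> = 1" "x \<oplus>\<^bsub>?R\<^esub> y = x + y" "x \<otimes>\<^bsub>?R\<^esub> y = x * y" for x y
    by (simp_all add: ring_of_type_algebra_def)
  have carrier: "carrier ?R = UNIV" by (simp add: ring_of_type_algebra_def)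
  show "\<ominus>\<^bsub>?R\<^esub> x = - x"
    by (rule sum_zero_eq_neg[symmetric]) (auto simp: simps carrier)
  show "x \<noteq> 0 \<Longrightarrow> inv\<^bsub>?R\<^esub> x = inverse x"
    by (rule comm_inv_char) (auto simp: simps carrier)
qed

lemma adjoin_incl: "s \<in> S \<Longrightarrow> s \<in> adjoin S"
  unfolding adjoin_def by (rule generate_field.incl) blast

lemma adjoin_Const: "to_fract (Const c) \<in> adjoin S"
  unfolding adjoin_def by (rule generate_field.incl) blast

lemma type_subfield_adjoin: "type_subfield (adjoin S)"
proof
  note simps = ring_of_type_algebra_simps and gen = generate_field.intros
  show one: "1 \<in> adjoin S" using gen(1) by (metis adjoin_def simps(2))
  show add: "x + y \<in> adjoin S" if "x \<in> adjoin S" "y \<in> adjoin S" for x y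
    using that gen(5) by (metis adjoin_def simps(3))
  show "x * y \<in> adjoin S" if "x \<in> adjoin S" "y \<in> adjoin S" for x y
    using that gen(6) by (metis adjoin_def simps(4))
  show um: "- x \<in> adjoin S" if "x \<in> adjoin S" for x
    using that gen(3) by (metis adjoin_def simps(5))
  \<comment> \<open>Zero arises as \<open>1 + - 1\<close>; it also serves as the inverse of
    zero.\<close>
  show "0 \<in> adjoin S" using add[OF one um[OF one]] by simp
  then show "inverse x \<in> adjoin S" if "x \<in> adjoin S" for x
    using that gen(4) by (metis adjoin_def simps(1,6) inverse_zero)
qed

lemma adjoin_least:
  assumes "type_subfield K" "range (\<lambda>c. to_fract (Const c)) \<subseteq> K" "S \<subseteq> K"
  shows "adjoin S \<subseteq> K"
proof
  interpret type_subfield K by fact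
  fix x assume "x \<in> adjoin S"
  then show "x \<in> K"
    unfolding adjoin_def
    by (induction rule: generate_field.induct)
      (use assms(2,3) in \<open>auto simp: ring_of_type_algebra_simps\<close>)
qed

section \<open>The field of rational functions\<close>

lemma poly_ring_add: "f \<in> poly_ring n \<Longrightarrow> g \<in> poly_ring n \<Longrightarrow> f + g \<in> poly_ring n"
  using Poly_Mapping.keys_add[of f g] unfolding poly_ring_def by blast

lemma poly_ring_uminus: "f \<in> poly_ring n \<Longrightarrow> - f \<in> poly_ring n"
  by (simp add: poly_ring_def)

lemma poly_ring_mult:
  assumes "f \<in> poly_ring n" "g \<in> poly_ring n"
  shows "f * g \<in> poly_ring n"
  unfolding poly_ring_def
proof (intro CollectI ballI)
  fix t assume "t \<in> Poly_Mapping.keys (f * g)"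
  then obtain a b where ab: "t = a + b" "a \<in> Poly_Mapping.keys f" "b \<in> Poly_Mapping.keys g"
    using keys_mult by blast
  then show "Poly_Mapping.keys t \<subseteq> {1..n}"
    using assms Poly_Mapping.keys_add[of a b] unfolding poly_ring_def by blast
qed

lemma poly_ring_Const: "Const c \<in> poly_ring n"
  by (auto simp: poly_ring_def Const_def)

lemma poly_ring_Var: "i \<in> {1..n} \<Longrightarrow> Var i \<in> poly_ring n"
  by (auto simp: poly_ring_def Var_def)

lemma poly_ring_0: "0 \<in> poly_ring n" and poly_ring_1: "1 \<in> poly_ring n"
  using poly_ring_Const[of 0] poly_ring_Const[of 1] by auto

lemma to_fract_rat_field: "f \<in> poly_ring n \<Longrightarrow> to_fract f \<in> rat_field n"
  unfolding rat_field_def to_fract_def using poly_ring_1 by fastforce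

lemma type_subfield_rat_field: "type_subfield (rat_field n)"
proof
  show "0 \<in> rat_field n" "1 \<in> rat_field n"
    using to_fract_rat_field[OF poly_ring_0] to_fract_rat_field[OF poly_ring_1] by auto
  show "- x \<in> rat_field n" "inverse x \<in> rat_field n" if "x \<in> rat_field n" for x :: "'a mpol fract"
  proof -
    obtain a b where ab: "x = Fract a b" "a \<in> poly_ring n" "b \<in> poly_ring n" "b \<noteq> 0"
      using \<open>x \<in> rat_field n\<close> by (auto simp: rat_field_def)
    then show "- x \<in> rat_field n"
      using poly_ring_uminus[of a n] by (auto simp: rat_field_def)
    show "inverse x \<in> rat_field n"
      using ab \<open>0 \<in> rat_field n\<close> by (cases "a = 0") (auto simp: rat_field_def fract_collapse)
  qed
  show "x + y \<in> rat_field n" "x * y \<in> rat_field n"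
    if xy: "x \<in> rat_field n" "y \<in> rat_field n" for x y :: "'a mpol fract"
  proof -
    obtain a b where ab: "x = Fract a b" "a \<in> poly_ring n" "b \<in> poly_ring n" "b \<noteq> 0"
      using xy by (auto simp: rat_field_def)
    obtain c d where cd: "y = Fract c d" "c \<in> poly_ring n" "d \<in> poly_ring n" "d \<noteq> 0"
      using xy by (auto simp: rat_field_def)
    have "x + y = Fract (a * d + c * b) (b * d)" "x * y = Fract (a * c) (b * d)"
      using ab cd by auto
    moreover have "b * d \<noteq> 0" using ab cd by simp
    ultimately show "x + y \<in> rat_field n" "x * y \<in> rat_field n"
      using ab(2,3) cd(2,3) unfolding rat_field_def
      by (blast intro: poly_ring_add poly_ring_mult)+
  qed
qed

lemma to_fract_power: "to_fract (f ^ k) = to_fract f ^ k"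
  by (induction k) auto

lemma to_fract_prod: "to_fract (prod f A) = (\<Prod>x\<in>A. to_fract (f x))"
  by (induction A rule: infinite_finite_induct) auto

text \<open>A polynomial is the sum of its monomials, so constants and variables generate
  everything. This is needed at the top of the tower, where all variables have been
  adjoined.\<close>

lemma rat_field_adjoin:
  assumes "to_fract ` Var ` {1..n} \<subseteq> S"
  shows "rat_field n \<subseteq> adjoin S"
proof -
  interpret type_subfield "adjoin S" by (rule type_subfield_adjoin)
  have *: "to_fract f \<in> adjoin S" if "f \<in> poly_ring n" for f
  proof -
    have "f = (\<Sum>t\<in>Poly_Mapping.keys f. Const (Poly_Mapping.lookup f t) *
        (\<Prod>i\<in>Poly_Mapping.keys t. Var i ^ Poly_Mapping.lookup t i))"
      using subst_Var_id[of f] unfolding subst_def mon_subst_def by simp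
    moreover have "to_fract \<dots> \<in> adjoin S"
      unfolding to_fract_sum to_fract_mult to_fract_prod to_fract_power
    proof (intro sum mult prod power adjoin_Const)
      fix t i assume "t \<in> Poly_Mapping.keys f" "i \<in> Poly_Mapping.keys t"
      then have "i \<in> {1..n}" using that unfolding poly_ring_def by blast
      then show "to_fract (Var i) \<in> adjoin S" using assms by (blast intro: adjoin_incl)
    qed
    ultimately show ?thesis by simp
  qed
  show ?thesis
    by (auto simp: rat_field_def Fract_conv_to_fract intro!: divide *)
qed

section \<open>The action on fractions and its fixed fields\<close>

lemma act_add: "act n g (a + b) = act n g a + act n g b"
  and act_mult: "act n g (a * b) = act n g a * act n g b"
  and act_prod: "act n g (\<Prod>i\<in>A. f i) = (\<Prod>i\<in>A. act n g (f i))"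
  and act_Const: "act n g (Const c) = Const c"
  by (simp_all add: act_def subst_add subst_mult subst_prod)

lemma act_fract_to_fract: "g \<in> GL n \<Longrightarrow> act_fract n g (to_fract f) = to_fract (act n g f)"
  using act_fract_Fract[of g n 1 f] act_Const[of n g 1] by (simp add: to_fract_def)

lemma act_fract_add:
  assumes "g \<in> GL n"
  shows "act_fract n g (u + v) = act_fract n g u + act_fract n g v"
proof -
  obtain a b where ab: "u = Fract a b" "b \<noteq> 0" by (cases u) auto
  obtain c d where cd: "v = Fract c d" "d \<noteq> 0" by (cases v) auto
  have nz: "act n g e \<noteq> 0" if "e \<noteq> 0" for e
    using act_inj[OF assms, of e 0] that by (auto simp: act_def)
  show ?thesis
    using ab cd nz assms by (simp add: act_fract_Fract act_add act_mult)
qed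

lemma act_fract_mult:
  assumes "g \<in> GL n"
  shows "act_fract n g (u * v) = act_fract n g u * act_fract n g v"
proof -
  obtain a b where ab: "u = Fract a b" "b \<noteq> 0" by (cases u) auto
  obtain c d where cd: "v = Fract c d" "d \<noteq> 0" by (cases v) auto
  show ?thesis
    using ab cd assms by (simp add: act_fract_Fract act_mult)
qed

lemma type_subfield_fixed:
  assumes "g \<in> GL n"
  shows "type_subfield {r. act_fract n g r = r}"
proof -
  have 0: "act_fract n g 0 = 0" and 1: "act_fract n g 1 = 1"
    using act_fract_to_fract[OF assms, of "Const 0"] act_fract_to_fract[OF assms, of "Const 1"]
    by (simp_all only: act_Const) simp_all
  have um: "act_fract n g (- x) = - act_fract n g x" for x
    using act_fract_add[OF assms, of x "- x"] 0 by (simp add: eq_neg_iff_add_eq_0 add.commute)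
  have "act_fract n g (inverse x) = inverse x" if "act_fract n g x = x" for x
  proof (cases "x = 0")
    case False
    then have "x * act_fract n g (inverse x) = 1"
      using act_fract_mult[OF assms, of x "inverse x"] 1 that by simp
    then show ?thesis by (metis inverse_unique)
  qed (use 0 in simp)
  with 0 1 um show ?thesis
    by unfold_locales (auto simp: act_fract_add act_fract_mult assms)
qed

lemma type_subfield_invariant_field:
  fixes G :: "'a::field mat set"
  assumes "G \<subseteq> GL n"
  shows "type_subfield (invariant_field n G)"
proof -
  interpret R: type_subfield "rat_field n :: 'a mpol fract set" by (rule type_subfield_rat_field)
  have F: "type_subfield {r. act_fract n g r = r}" if "g \<in> G" for g
    using that assms by (intro type_subfield_fixed) auto
  note * = type_subfield.zero[OF F] type_subfield.one[OF F] type_subfield.add[OF F]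
    type_subfield.mult[OF F] type_subfield.uminus[OF F] type_subfield.inverse[OF F]
  show ?thesis
    by unfold_locales (use * in \<open>auto simp: invariant_field_def\<close>)
qed

text \<open>The fixed elements form a subfield, so being fixed passes from the generators to all of
  \<open>adjoin\<close>.\<close>

lemma adjoin_fixed:
  assumes "g \<in> GL n" "\<And>f. f \<in> S \<Longrightarrow> act n g f = f" "r \<in> adjoin (to_fract ` S)"
  shows "act_fract n g r = r"
proof -
  have "adjoin (to_fract ` S) \<subseteq> {r. act_fract n g r = r}"
    using assms(1,2) by (intro adjoin_least type_subfield_fixed)
      (auto simp: act_fract_to_fract act_Const)
  then show ?thesis using assms(3) by blast
qed

section \<open>The symplectic form in coordinates\<close>

text \<open>Flattens the blocks: row \<open>i\<close> meets column \<open>2*m-1-i\<close>, with sign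
  plus in the upper half. The rows of \<open>X2\<close> become rows \<open>m-1\<close> and
  \<open>m\<close> and follow the same rule.\<close>

lemma symp_form_eq:
  assumes "m \<ge> 1"
  shows "symp_form m = mat (2*m) (2*m)
    (\<lambda>(i, j). if i + j + 1 = 2*m then (if i < m then 1 else - 1) else (0 :: 'a::field))"
proof (rule eq_matI; unfold dim_row_mat dim_col_mat)
  show dims: "dim_row (symp_form m) = 2*m" "dim_col (symp_form m) = 2*m"
    using assms by (auto simp: symp_form_def append_rows_def antidiag_def X2_def mat_of_rows_list_def)
  fix i j assume ij: "i < 2*m" "j < 2*m"
  have X2: "X2 $$ (a, b) = (if a + b + 1 = 2 then if a = 0 then 1 else - 1 else (0 :: 'a))"
    if "a < 2" "b < 2" for a b
  proof -
    have "a = 0 \<or> a = 1" "b = 0 \<or> b = 1" using that by auto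
    then show ?thesis by (auto simp: X2_def mat_of_rows_list_def)
  qed
  have X2_dim: "dim_row X2 = 2" "dim_col X2 = 2"
    by (auto simp: X2_def mat_of_rows_list_def)
  show "symp_form m $$ (i, j) = mat (2*m) (2*m)
    (\<lambda>(i, j). if i + j + 1 = 2*m then (if i < m then 1 else - 1) else (0 :: 'a)) $$ (i, j)"
  proof -
    obtain k where k: "m = Suc k" using assms by (cases m) auto
    \<comment> \<open>One case for each of the nine blocks, cut at \<open>k = m-1\<close> and
      \<open>k + 2\<close>.\<close>
    consider "i < k" "j < k" | "i < k" "k \<le> j" "j < k + 2" | "i < k" "k + 2 \<le> j"
      | "k \<le> i" "i < k + 2" "j < k" | "k \<le> i" "i < k + 2" "k \<le> j" "j < k + 2"
      | "k \<le> i" "i < k + 2" "k + 2 \<le> j"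
      | "k + 2 \<le> i" "j < k" | "k + 2 \<le> i" "k \<le> j" "j < k + 2" | "k + 2 \<le> i" "k + 2 \<le> j"
      by linarith
    then show ?thesis
    proof cases
      case 5
      then have "i = k \<or> i = Suc k" "j = k \<or> j = Suc k" by auto
      then show ?thesis
        using ij by (auto simp: k symp_form_def append_rows_def antidiag_def X2_dim X2)
    qed (use ij in \<open>auto simp: k symp_form_def append_rows_def antidiag_def X2_dim\<close>)
  qed
qed

lemma index_mult_sum:
  assumes "B \<in> carrier_mat n n" "C \<in> carrier_mat n n" "a < n" "b < n"
  shows "(B * C) $$ (a, b) = (\<Sum>j<n. B $$ (a, j) * C $$ (j, b))"
  using assms by (auto simp: scalar_prod_def atLeast0LessThan)

text \<open>The sum is the alternating form applied to columns \<open>a\<close> and \<open>b\<close>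
  of \<open>A\<close>, with rows \<open>s\<close> and \<open>2*m-1-s\<close> paired.\<close>

lemma preserves_form_iff:
  fixes A :: "'a::field mat"
  assumes "m \<ge> 1" and A: "A \<in> carrier_mat (2*m) (2*m)"
  shows "A\<^sup>T * symp_form m * A = symp_form m \<longleftrightarrow>
    (\<forall>a<2*m. \<forall>b<2*m. (\<Sum>s<m. A $$ (s, a) * A $$ (2*m-1-s, b) - A $$ (2*m-1-s, a) * A $$ (s, b))
      = symp_form m $$ (a, b))"
proof -
  let ?Y = "symp_form m :: 'a mat"
  have Y: "?Y \<in> carrier_mat (2*m) (2*m)" by (simp add: symp_form_eq[OF assms(1)])
  have Yij: "?Y $$ (i, j) = (if j = 2*m-1-i then if i < m then 1 else - 1 else 0)"
    if "i < 2*m" "j < 2*m" for i j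
    using that by (auto simp: symp_form_eq[OF assms(1)])
  have entry: "(A\<^sup>T * ?Y * A) $$ (a, b) =
      (\<Sum>s<m. A $$ (s, a) * A $$ (2*m-1-s, b) - A $$ (2*m-1-s, a) * A $$ (s, b))"
    if ab: "a < 2*m" "b < 2*m" for a b
  proof -
    have AY: "(A\<^sup>T * ?Y) $$ (a, j) = (\<Sum>i<2*m. A $$ (i, a) * ?Y $$ (i, j))" if "j < 2*m" for j
      using A Y ab that by (subst index_mult_sum[of _ "2*m"]) auto
    have "(A\<^sup>T * ?Y * A) $$ (a, b) = (\<Sum>j<2*m. (A\<^sup>T * ?Y) $$ (a, j) * A $$ (j, b))"
      using A Y ab by (intro index_mult_sum mult_carrier_mat[of _ _ "2*m"]) (simp_all only: transpose_carrier_mat)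
    also have "\<dots> = (\<Sum>j<2*m. \<Sum>i<2*m. A $$ (i, a) * ?Y $$ (i, j) * A $$ (j, b))"
      by (simp add: AY sum_distrib_right)
    also have "\<dots> = (\<Sum>i<2*m. \<Sum>j<2*m. A $$ (i, a) * ?Y $$ (i, j) * A $$ (j, b))"
      by (rule sum.swap)
    also have "\<dots> = (\<Sum>i<2*m. A $$ (i, a) * (if i < m then 1 else - 1) * A $$ (2*m-1-i, b))"
    proof (rule sum.cong[OF refl])
      fix i assume i: "i \<in> {..<2*m}"
      have "(\<Sum>j<2*m. A $$ (i, a) * ?Y $$ (i, j) * A $$ (j, b)) =
          (\<Sum>j<2*m. if j = 2*m-1-i then A $$ (i, a) * (if i < m then 1 else - 1) * A $$ (2*m-1-i, b) else 0)"
        using i by (intro sum.cong) (auto simp: Yij)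
      then show "(\<Sum>j<2*m. A $$ (i, a) * ?Y $$ (i, j) * A $$ (j, b)) =
          A $$ (i, a) * (if i < m then 1 else - 1) * A $$ (2*m-1-i, b)"
        using i by simp
    qed
    \<comment> \<open>The lower half carries the minus sign; the reflection
      \<open>s = 2*m-1-i\<close> folds it onto the upper half.\<close>
    also have "{..<2*m} = {..<m} \<union> {m..<2*m}" by auto
    also have "(\<Sum>i\<in>{..<m} \<union> {m..<2*m}. A $$ (i, a) * (if i < m then 1 else - 1) * A $$ (2*m-1-i, b)) =
        (\<Sum>s<m. A $$ (s, a) * A $$ (2*m-1-s, b)) + (\<Sum>i=m..<2*m. - (A $$ (i, a) * A $$ (2*m-1-i, b)))"
      by (subst sum.union_disjoint) auto
    also have "(\<Sum>i=m..<2*m. - (A $$ (i, a) * A $$ (2*m-1-i, b))) =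
        (\<Sum>s<m. - (A $$ (2*m-1-s, a) * A $$ (s, b)))"
      by (rule sum.reindex_bij_witness[of _ "\<lambda>s. 2*m-1-s" "\<lambda>i. 2*m-1-i"]) auto
    finally show ?thesis by (simp add: sum_subtractf sum_negf)
  qed
  show ?thesis
  proof
    assume "A\<^sup>T * ?Y * A = ?Y"
    then show "\<forall>a<2*m. \<forall>b<2*m. (\<Sum>s<m. A $$ (s, a) * A $$ (2*m-1-s, b) - A $$ (2*m-1-s, a) * A $$ (s, b))
        = ?Y $$ (a, b)"
      using entry by simp
  next
    assume "\<forall>a<2*m. \<forall>b<2*m. (\<Sum>s<m. A $$ (s, a) * A $$ (2*m-1-s, b) - A $$ (2*m-1-s, a) * A $$ (s, b))
        = ?Y $$ (a, b)"
    then show "A\<^sup>T * ?Y * A = ?Y"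
      using A Y entry by (intro eq_matI) (simp_all del: index_mult_mat(1))
  qed
qed

text \<open>Forward substitution: in entry \<open>(i, j)\<close> of \<open>g * A\<close> with
  \<open>i \<le> j\<close>, the terms with \<open>k > i\<close> vanish since \<open>g\<close> is
  lower triangular, and those with \<open>k < i\<close> by induction. This leaves
  \<open>A $$ (i, j)\<close>.\<close>

lemma lower_unitriangular_inverse:
  fixes g A :: "'a::field mat"
  assumes g: "g \<in> lower_unitriangular n" and A: "A \<in> carrier_mat n n" "g * A = 1\<^sub>m n"
  shows "A \<in> lower_unitriangular n"
proof -
  have "A $$ (i, j) = (if i = j then 1 else 0)" if "i < n" "j < n" "i \<le> j" for i j
    using that
  proof (induction i rule: less_induct)
    case (less i)
    have "(g * A) $$ (i, j) = (\<Sum>k<n. g $$ (i, k) * A $$ (k, j))"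
      using less.prems g A(1) by (intro index_mult_sum) (auto simp: lower_unitriangular_def)
    also have "\<dots> = (\<Sum>k<n. if k = i then A $$ (i, j) else 0)"
    proof (rule sum.cong[OF refl])
      fix k assume "k \<in> {..<n}"
      then show "g $$ (i, k) * A $$ (k, j) = (if k = i then A $$ (i, j) else 0)"
        using less g by (cases k i rule: linorder_cases) (auto simp: lower_unitriangular_def)
    qed
    finally show ?case using less.prems unfolding A(2) by simp
  qed
  then show ?thesis using A(1) by (auto simp: lower_unitriangular_def)
qed

lemma sylow_Sp_subset: "sylow_Sp m \<subseteq> GL (2*m)"
  using lower_unitriangular_GL by (auto simp: sylow_Sp_def)

lemma sylow_Sp_inv:
  fixes g :: "'a::field mat"
  assumes "m \<ge> 1" and g: "g \<in> sylow_Sp m"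
  shows "inv\<^bsub>ring_mat TYPE('a) (2*m) ()\<^esub> g \<in> sylow_Sp m" (is "?A \<in> _")
proof -
  interpret ring "ring_mat TYPE('a) (2*m) ()" by (rule ring_mat)
  have gU: "g \<in> GL (2*m)" using g sylow_Sp_subset by auto
  have gc: "g \<in> carrier_mat (2*m) (2*m)" and A: "?A \<in> carrier_mat (2*m) (2*m)" "g * ?A = 1\<^sub>m (2*m)"
    using Units_closed[OF gU] Units_inv_closed[OF gU] Units_r_inv[OF gU] by (auto simp: ring_mat_simps)
  let ?Y = "symp_form m :: 'a mat"
  have Y: "?Y \<in> carrier_mat (2*m) (2*m)" by (simp add: symp_form_eq[OF assms(1)])
  have gY: "g\<^sup>T * ?Y * g = ?Y" using g by (simp add: sylow_Sp_def)
  \<comment> \<open>Once the form is replaced by \<open>g\<^sup>T * ?Y * g\<close>, the factors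
    \<open>g\<close> cancel against their inverses.\<close>
  have "?A\<^sup>T * ?Y * ?A = ?A\<^sup>T * (g\<^sup>T * ?Y * g) * ?A" by (simp add: gY)
  also have "\<dots> = (g * ?A)\<^sup>T * ?Y * (g * ?A)"
    using gc A(1) Y by (simp add: transpose_mult[OF gc A(1)] assoc_mult_mat[of _ "2*m" "2*m" _ "2*m" _ "2*m"])
  also have "\<dots> = ?Y" using Y by (simp add: A(2))
  finally show ?thesis
    using lower_unitriangular_inverse[OF _ A, of] g by (simp add: sylow_Sp_def)
qed

text \<open>From here on variables are mostly written \<open>Var (Suc a)\<close> with
  \<open>a\<close> counted from 0, in step with the matrix entries.\<close>

lemma lin_subst_Suc:
  assumes "i < n"
  shows "lin_subst n A (Suc i) = (\<Sum>a<n. Const (A $$ (i, a)) * Var (Suc a))"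
proof -
  have "lin_subst n A (Suc i) = (\<Sum>j=1..n. Const (A $$ (i, j - 1)) * Var j)"
    using assms by (simp add: lin_subst_def)
  also have "\<dots> = (\<Sum>a<n. Const (A $$ (i, a)) * Var (Suc a))"
    by (rule sum.reindex_bij_witness[of _ Suc "\<lambda>j. j - 1"]) auto
  finally show ?thesis .
qed

text \<open>
  The inverses of these group elements fix the first \<open>i\<close> variables and add an arbitrary linear
  combination of the first \<open>min i (2m - i)\<close> variables to the next one. For \<open>i < m\<close> such a matrix
  acts on the isotropic span of the first \<open>m\<close> variables and dually on the others; for \<open>i \<ge> m\<close> it is given
  by a symmetric \<open>m\<close> by \<open>m\<close> matrix.
\<close>

lemma sylow_Sp_stabilizer:
  fixes w :: "nat \<Rightarrow> 'a::field"
  assumes m: "m \<ge> 1" and i: "i < 2*m"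
  obtains A where "A \<in> sylow_Sp m"
    "\<And>r c. r < i \<Longrightarrow> c < 2*m \<Longrightarrow> A $$ (r, c) = (if r = c then 1 else 0)"
    "\<And>c. c < 2*m \<Longrightarrow> A $$ (i, c) = (if i = c then 1 else if c < min i (2*m-i) then w c else 0)"
proof (cases "i < m")
  case True
  \<comment> \<open>The identity with \<open>w\<close> added in row \<open>i\<close> left of the
    diagonal, and the dual correction subtracted in column \<open>2*m-1-i\<close> below the
    diagonal.\<close>
  define E where "E r c = (if c = r then 1 else 0) + (if r = i \<and> c < i then w c else 0)
    - (if r > 2*m-1-i \<and> c = 2*m-1-i then w (2*m-1-r) else 0)" for r c
  define A where "A = mat (2*m) (2*m) (\<lambda>(r, c). E r c)"
  \<comment> \<open>This is half of the form on columns \<open>a\<close> and \<open>b\<close>;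
    exchanging them and subtracting gives the whole.\<close>
  have E: "(\<Sum>s<m. E s a * E (2*m-1-s) b) = (if a < m \<and> a + b + 1 = 2*m then 1 else 0)" for a b
  proof -
    have "(\<Sum>s<m. E s a * E (2*m-1-s) b) =
       (\<Sum>s<m. (if s = a then (if a + b + 1 = 2*m then 1 else 0) - (if a < i \<and> b = 2*m-1-i then w a else 0) else 0)
           + (if s = i then (if a < i \<and> b = 2*m-1-i then w a else 0) else 0))"
    proof (rule sum.cong[OF refl])
      fix s assume s: "s \<in> {..<m}"
      \<comment> \<open>As \<open>s < m \<le> 2*m-1-i\<close>, the dual correction does not reach
        row \<open>s\<close>.\<close>
      have 1: "E s a = (if s = a then 1 else 0) + (if s = i \<and> a < i then w a else 0)"
        using s True by (auto simp: E_def)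
      have c: "(2*m-1-s = i) = False" "(2*m-1-s > 2*m-1-i) = (s < i)" "(b = 2*m-1-s) = (s + b + 1 = 2*m)"
        "2*m-1-(2*m-1-s) = s" and c': "s = i \<Longrightarrow> (s + b + 1 = 2*m) = (b = 2*m-1-i)"
        using s True by auto
      have 2: "E (2*m-1-s) b = (if s + b + 1 = 2*m then 1 else 0) - (if s < i \<and> b = 2*m-1-i then w s else 0)"
        unfolding E_def c by simp
      show "E s a * E (2*m-1-s) b =
         (if s = a then (if a + b + 1 = 2*m then 1 else 0) - (if a < i \<and> b = 2*m-1-i then w a else 0) else 0)
           + (if s = i then (if a < i \<and> b = 2*m-1-i then w a else 0) else 0)"
        unfolding 1 2 using c' by (cases "s = i"; cases "s = a"; simp)
    qed
    also have "\<dots> = (if a < m \<and> a + b + 1 = 2*m then 1 else 0)"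
      using True by (auto simp: sum.distrib)
    finally show ?thesis .
  qed
  have "A\<^sup>T * symp_form m * A = symp_form m"
  proof (subst preserves_form_iff[OF m]; (intro allI impI)?)
    fix a b assume ab: "a < 2*m" "b < 2*m"
    have "(\<Sum>s<m. A $$ (s, a) * A $$ (2*m-1-s, b) - A $$ (2*m-1-s, a) * A $$ (s, b)) =
        (\<Sum>s<m. E s a * E (2*m-1-s) b) - (\<Sum>s<m. E s b * E (2*m-1-s) a)"
      unfolding sum_subtractf[symmetric] using ab by (intro sum.cong) (auto simp: A_def)
    then show "(\<Sum>s<m. A $$ (s, a) * A $$ (2*m-1-s, b) - A $$ (2*m-1-s, a) * A $$ (s, b))
        = symp_form m $$ (a, b)"
      using ab unfolding E by (auto simp: symp_form_eq[OF m])
  qed (simp add: A_def)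
  moreover have "A \<in> lower_unitriangular (2*m)"
    using True by (auto simp: A_def E_def lower_unitriangular_def)
  ultimately show ?thesis
    using True i by (intro that[of A]) (auto simp: sylow_Sp_def A_def E_def)
next
  case False
  define n where "n = 2*m - i"
  have n: "1 \<le> n" "n \<le> m" "i = 2*m - n" using False i by (auto simp: n_def)
  \<comment> \<open>A symmetric matrix with \<open>w\<close> in row and column
    \<open>n - 1 = 2*m-1-i\<close> and zeros elsewhere. Row \<open>r\<close> of the lower half
    receives its row \<open>2*m-1-r\<close>, so rows before \<open>i\<close> stay unchanged.\<close>
  define S where "S s t = (if s = n - 1 \<and> t < n then w t else if t = n - 1 \<and> s < n then w s else 0)" for s t
  define E where "E r c = (if c = r then 1 else 0) + (if m \<le> r then S (2*m-1-r) c else 0)" for r c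
  define A where "A = mat (2*m) (2*m) (\<lambda>(r, c). E r c)"
  \<comment> \<open>Half of the form again, with a surplus \<open>S a b\<close> that cancels by
    symmetry when the other half is subtracted.\<close>
  have E: "(\<Sum>s<m. E s a * E (2*m-1-s) b) = (if a < m \<and> a + b + 1 = 2*m then 1 else 0) + S a b" for a b
  proof -
    have "(\<Sum>s<m. E s a * E (2*m-1-s) b) =
       (\<Sum>s<m. if s = a then (if a + b + 1 = 2*m then 1 else 0) + S a b else 0)"
      by (intro sum.cong) (auto simp: E_def)
    also have "\<dots> = (if a < m \<and> a + b + 1 = 2*m then 1 else 0) + S a b"
      using n by (auto simp: S_def)
    finally show ?thesis .
  qed
  have S_sym: "S a b = S b a" for a b
    using n by (auto simp: S_def)
  have "A\<^sup>T * symp_form m * A = symp_form m"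
  proof (subst preserves_form_iff[OF m]; (intro allI impI)?)
    fix a b assume ab: "a < 2*m" "b < 2*m"
    have "(\<Sum>s<m. A $$ (s, a) * A $$ (2*m-1-s, b) - A $$ (2*m-1-s, a) * A $$ (s, b)) =
        (\<Sum>s<m. E s a * E (2*m-1-s) b) - (\<Sum>s<m. E s b * E (2*m-1-s) a)"
      unfolding sum_subtractf[symmetric] using ab by (intro sum.cong) (auto simp: A_def)
    then show "(\<Sum>s<m. A $$ (s, a) * A $$ (2*m-1-s, b) - A $$ (2*m-1-s, a) * A $$ (s, b))
        = symp_form m $$ (a, b)"
      using ab S_sym[of a b] unfolding E by (auto simp: symp_form_eq[OF m])
  qed (simp add: A_def)
  moreover have "A \<in> lower_unitriangular (2*m)"
    using n by (auto simp: A_def E_def S_def lower_unitriangular_def)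
  ultimately show ?thesis
    using n by (intro that[of A]) (auto simp: sylow_Sp_def A_def E_def S_def)
qed

section \<open>Invariance of the generators\<close>

lemma Const_uminus: "Const (- c) = - Const c"
  by (simp add: Const_def single_uminus)

lemma Const_diff: "Const (c - d) = Const c - Const d"
  using Const_simps(3)[of c "- d"] by (simp add: Const_uminus)

lemma Const_power: "Const (c ^ k) = Const c ^ k"
  by (induction k) auto

lemma Const_eq_iff: "Const c = Const d \<longleftrightarrow> c = d"
  by (metis Const_def lookup_single_eq)

lemma Const_mult_Var: "Const c * Var j = Poly_Mapping.single (Poly_Mapping.single j 1) c"
  by (simp add: Const_def Var_def mult_single)

lemma linear_form_inj:
  assumes "(\<Sum>a<k. Const (v a) * Var (Suc a)) = (\<Sum>a<k. Const (w a) * Var (Suc a))" "c < k"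
  shows "v c = w c"
proof -
  have inj: "Poly_Mapping.single (Suc a) (Suc 0) = Poly_Mapping.single (Suc c) (Suc 0) \<longleftrightarrow> a = c" for a
    by (metis lookup_single_eq lookup_single_not_eq nat.inject nat.distinct(1))
  have "Poly_Mapping.lookup (\<Sum>a<k. Const (u a) * Var (Suc a)) (Poly_Mapping.single (Suc c) 1) = u c"
    for u :: "nat \<Rightarrow> 'a"
    using assms(2) by (simp add: lookup_sum Const_mult_Var lookup_single inj when_def)
  from this[of v] this[of w] assms(1) show ?thesis by simp
qed

section \<open>Frobenius powers of polynomials and fractions\<close>

text \<open>The constants are \<open>q\<close> elements with \<open>c ^ q = c\<close>, closed under
  adding one, so \<open>power_card_additive\<close> applies.\<close>

lemma power_q_add:
  fixes u v :: "'a::{field,finite} mpol fract"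
  assumes "q = card (UNIV :: 'a set)"
  shows "(u + v) ^ q = u ^ q + v ^ q"
proof (rule power_card_additive)
  let ?F = "range (\<lambda>c :: 'a. to_fract (Const c))"
  show "card ?F = q"
    unfolding assms by (rule card_image) (auto intro!: injI simp: Const_eq_iff)
  show "q > 0" using assms by (simp add: finite_UNIV_card_ge_0)
  show "c ^ q = c \<and> c + 1 \<in> ?F" if c: "c \<in> ?F" for c
  proof
    obtain d where d: "c = to_fract (Const d)" using c by blast
    then show "c ^ q = c"
      by (simp add: assms finite_field_power_card flip: to_fract_power Const_power)
    have "c + 1 = to_fract (Const (d + 1))" by (simp add: d)
    then show "c + 1 \<in> ?F" by blast
  qed
qed simp

lemma power_q_sum:
  fixes f :: "'b \<Rightarrow> 'a::{field,finite} mpol fract"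
  assumes q: "q = card (UNIV :: 'a set)"
  shows "sum f A ^ q ^ k = (\<Sum>x\<in>A. f x ^ q ^ k)"
proof (induction k)
  case (Suc k)
  have q0: "q > 0" using q by (simp add: finite_UNIV_card_ge_0)
  have *: "sum g A ^ q = (\<Sum>x\<in>A. g x ^ q)" for g :: "'b \<Rightarrow> 'a mpol fract"
    by (induction A rule: infinite_finite_induct) (simp_all add: power_q_add[OF q] zero_power q0)
  have "sum f A ^ q ^ Suc k = (\<Sum>x\<in>A. f x ^ q ^ k) ^ q"
    by (simp add: Suc[symmetric] power_mult[symmetric] mult.commute)
  then show ?case
    by (simp add: * power_mult[symmetric] mult.commute)
qed simp

text \<open>Additivity was derived in a field; it comes back to polynomials because
  \<open>to_fract\<close> is injective.\<close>

lemma mpol_power_q_sum: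
  fixes f :: "'b \<Rightarrow> 'a::{field,finite} mpol"
  assumes "q = card (UNIV :: 'a set)"
  shows "sum f A ^ q ^ k = (\<Sum>x\<in>A. f x ^ q ^ k)"
proof -
  have "to_fract (sum f A ^ q ^ k) = to_fract (\<Sum>x\<in>A. f x ^ q ^ k)"
    by (simp add: to_fract_power power_q_sum[OF assms])
  then show ?thesis by (simp only: to_fract_eq_iff)
qed

text \<open>Summing \<open>u - v\<close> and \<open>v\<close> over the two Booleans gives
  \<open>u\<close>; this avoids the sign of \<open>(- 1) ^ q\<close>.\<close>

lemma power_q_diff:
  fixes u v :: "'a::{field,finite} mpol fract"
  assumes q: "q = card (UNIV :: 'a set)"
  shows "(u - v) ^ q ^ k = u ^ q ^ k - v ^ q ^ k"
  using power_q_sum[OF q, of "\<lambda>b. if b then u - v else v" UNIV k] by (simp add: UNIV_bool)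

lemma Const_power_q:
  fixes c :: "'a::{field,finite}"
  assumes "q = card (UNIV :: 'a set)"
  shows "Const c ^ q ^ k = Const c"
proof (induction k)
  case (Suc k)
  have "Const c ^ q ^ Suc k = (Const c ^ q ^ k) ^ q"
    by (simp add: power_mult[symmetric] mult.commute)
  with Suc have "Const c ^ q ^ Suc k = Const (c ^ q)"
    by (simp add: Const_power)
  then show ?case by (simp add: assms finite_field_power_card)
qed simp

lemma h_poly_eq:
  "h_poly m q k = (\<Sum>s<m. Var (Suc (2*m-1-s)) ^ q ^ k * Var (Suc s) - Var (Suc (2*m-1-s)) * Var (Suc s) ^ q ^ k)"
  unfolding h_poly_def
  by (rule sum.reindex_bij_witness[of _ Suc "\<lambda>i. i - 1"]) (auto simp: Suc_diff_le)

text \<open>The point is that the right side does not mention \<open>A\<close>. The polynomial pairs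
  the vector of variables with its Frobenius image; \<open>A\<close> has entries in the base field,
  so it commutes with Frobenius and preserves the pairing.\<close>

lemma subst_h_poly:
  fixes A :: "'a::{field,finite} mat"
  assumes q: "q = card (UNIV :: 'a set)" and m: "m \<ge> 1"
    and A: "A \<in> carrier_mat (2*m) (2*m)" "A\<^sup>T * symp_form m * A = symp_form m"
  shows "subst (lin_subst (2*m) A) (h_poly m q k) =
    (\<Sum>a<2*m. \<Sum>b<2*m. Const (symp_form m $$ (a, b)) * (Var (Suc a) * Var (Suc b) ^ q ^ k))"
proof -
  define x :: "nat \<Rightarrow> 'a mpol" where "x a = Var (Suc a)" for a
  define l where "l i = (\<Sum>a<2*m. Const (A $$ (i, a)) * x a)" for i
  have l: "subst (lin_subst (2*m) A) (Var (Suc i)) = l i" if "i < 2*m" for i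
    using that by (simp add: lin_subst_Suc l_def x_def)
  have lq: "l i ^ q ^ k = (\<Sum>b<2*m. Const (A $$ (i, b)) * x b ^ q ^ k)" for i
    by (simp add: l_def mpol_power_q_sum[OF q] power_mult_distrib Const_power_q[OF q])
  have "subst (lin_subst (2*m) A) (h_poly m q k) =
      (\<Sum>s<m. l (2*m-1-s) ^ q ^ k * l s - l (2*m-1-s) * l s ^ q ^ k)"
  proof -
    have diff: "subst (lin_subst (2*m) A) (f - g) = subst (lin_subst (2*m) A) f - subst (lin_subst (2*m) A) g" for f g
      using subst_add[of "lin_subst (2*m) A" "f - g" g] by simp
    show ?thesis
      unfolding h_poly_eq subst_sum diff subst_mult subst_power
    proof (rule sum.cong[OF refl])
      fix s assume "s \<in> {..<m}"
      then have "s < 2*m" "2*m-1-s < 2*m" by auto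
      from this[THEN l] show "subst (lin_subst (2*m) A) (Var (Suc (2*m-1-s))) ^ q ^ k * subst (lin_subst (2*m) A) (Var (Suc s))
        - subst (lin_subst (2*m) A) (Var (Suc (2*m-1-s))) * subst (lin_subst (2*m) A) (Var (Suc s)) ^ q ^ k
        = l (2*m-1-s) ^ q ^ k * l s - l (2*m-1-s) * l s ^ q ^ k"
        by (simp only:)
    qed
  qed
  also have "\<dots> = (\<Sum>s<m. \<Sum>a<2*m. \<Sum>b<2*m.
      Const (A $$ (s, a) * A $$ (2*m-1-s, b) - A $$ (2*m-1-s, a) * A $$ (s, b)) * (x a * x b ^ q ^ k))"
  proof (rule sum.cong[OF refl])
    fix s
    have 1: "l (2*m-1-s) ^ q ^ k * l s = (\<Sum>a<2*m. \<Sum>b<2*m. Const (A $$ (s, a) * A $$ (2*m-1-s, b)) * (x a * x b ^ q ^ k))"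
    proof -
      have "l (2*m-1-s) ^ q ^ k * l s = l s * (\<Sum>b<2*m. Const (A $$ (2*m-1-s, b)) * x b ^ q ^ k)"
        by (simp only: lq mult.commute)
      also have "\<dots> = (\<Sum>a<2*m. \<Sum>b<2*m. Const (A $$ (s, a) * A $$ (2*m-1-s, b)) * (x a * x b ^ q ^ k))"
        unfolding l_def sum_product by (simp add: mult_ac)
      finally show ?thesis .
    qed
    have 2: "l (2*m-1-s) * l s ^ q ^ k = (\<Sum>a<2*m. \<Sum>b<2*m. Const (A $$ (2*m-1-s, a) * A $$ (s, b)) * (x a * x b ^ q ^ k))"
    proof -
      have "l (2*m-1-s) * l s ^ q ^ k = l (2*m-1-s) * (\<Sum>b<2*m. Const (A $$ (s, b)) * x b ^ q ^ k)"
        by (simp only: lq)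
      also have "\<dots> = (\<Sum>a<2*m. \<Sum>b<2*m. Const (A $$ (2*m-1-s, a) * A $$ (s, b)) * (x a * x b ^ q ^ k))"
        unfolding l_def sum_product by (simp add: mult_ac)
      finally show ?thesis .
    qed
    show "l (2*m-1-s) ^ q ^ k * l s - l (2*m-1-s) * l s ^ q ^ k = (\<Sum>a<2*m. \<Sum>b<2*m.
      Const (A $$ (s, a) * A $$ (2*m-1-s, b) - A $$ (2*m-1-s, a) * A $$ (s, b)) * (x a * x b ^ q ^ k))"
      unfolding 1 2 Const_diff left_diff_distrib sum_subtractf ..
  qed
  also have "\<dots> = (\<Sum>a<2*m. \<Sum>b<2*m. \<Sum>s<m.
      Const (A $$ (s, a) * A $$ (2*m-1-s, b) - A $$ (2*m-1-s, a) * A $$ (s, b)) * (x a * x b ^ q ^ k))"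
    by (rule trans[OF sum.swap sum.cong[OF refl sum.swap]])
  also have "\<dots> = (\<Sum>a<2*m. \<Sum>b<2*m. Const (symp_form m $$ (a, b)) * (x a * x b ^ q ^ k))"
    using A(2) unfolding preserves_form_iff[OF m A(1)] sum_distrib_right[symmetric] Const_sum[symmetric]
    by (intro sum.cong refl) simp
  finally show ?thesis by (simp add: x_def)
qed

lemma act_h_poly:
  fixes g :: "'a::{field,finite} mat"
  assumes q: "q = card (UNIV :: 'a set)" and m: "m \<ge> 1" and g: "g \<in> sylow_Sp m"
  shows "act (2*m) g (h_poly m q k) = h_poly m q k"
proof -
  have A: "inv\<^bsub>ring_mat TYPE('a) (2*m) ()\<^esub> g \<in> sylow_Sp m"
    by (rule sylow_Sp_inv[OF m g])
  have "(symp_form m :: 'a mat) \<in> carrier_mat (2*m) (2*m)" by (simp add: symp_form_eq[OF m])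
  then have Y: "(1\<^sub>m (2*m))\<^sup>T * symp_form m * 1\<^sub>m (2*m) = (symp_form m :: 'a mat)" by simp
  \<comment> \<open>The inverse of \<open>g\<close> and the identity both preserve the form, so the
    two substitutions give the same expression.\<close>
  have "act (2*m) g (h_poly m q k) = subst (lin_subst (2*m) (1\<^sub>m (2*m))) (h_poly m q k)"
    unfolding act_def using A Y
    by (subst (1 2) subst_h_poly[OF q m]) (auto simp: sylow_Sp_def lower_unitriangular_def)
  then show ?thesis by simp
qed

lemma sylow_Sp_mult:
  fixes A B :: "'a::field mat"
  assumes m: "m \<ge> 1" and AB: "A \<in> sylow_Sp m" "B \<in> sylow_Sp m"
  shows "A * B \<in> sylow_Sp m"
proof -
  let ?n = "2*m" and ?Y = "symp_form m :: 'a mat"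
  have Y: "?Y \<in> carrier_mat ?n ?n" by (simp add: symp_form_eq[OF m])
  have c: "A \<in> carrier_mat ?n ?n" "B \<in> carrier_mat ?n ?n"
    using AB by (auto simp: sylow_Sp_def lower_unitriangular_def)
  have "(A * B)\<^sup>T * ?Y * (A * B) = B\<^sup>T * (A\<^sup>T * ?Y * A) * B"
    using c Y by (simp add: transpose_mult[OF c] assoc_mult_mat[of _ "2*m" "2*m" _ "2*m" _ "2*m"])
  also have "\<dots> = ?Y" using AB by (simp add: sylow_Sp_def)
  finally have form: "(A * B)\<^sup>T * ?Y * (A * B) = ?Y" .
  have "(A * B) $$ (i, j) = (if i = j then 1 else 0)" if "i < ?n" "j < ?n" "i \<le> j" for i j
  proof -
    have "(A * B) $$ (i, j) = (\<Sum>k<?n. A $$ (i, k) * B $$ (k, j))"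
      by (rule index_mult_sum[OF c that(1,2)])
    also have "\<dots> = (\<Sum>k<?n. if k = i then if i = j then 1 else 0 else 0)"
    proof (rule sum.cong[OF refl])
      fix k assume "k \<in> {..<?n}"
      then show "A $$ (i, k) * B $$ (k, j) = (if k = i then if i = j then 1 else 0 else 0)"
        using that AB by (cases k i rule: linorder_cases; cases "i = j")
          (auto simp: sylow_Sp_def lower_unitriangular_def)
    qed
    finally show ?thesis using that(1) by simp
  qed
  then show ?thesis using form c by (auto simp: sylow_Sp_def lower_unitriangular_def)
qed

section \<open>Orbits of the variables\<close>

definition orbit :: "nat \<Rightarrow> nat \<Rightarrow> 'a::field mpol set" where
  "orbit m i = (\<lambda>g. act (2*m) g (Var i)) ` sylow_Sp m"

lemma orbit_eq:
  assumes m: "m \<ge> 1"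
  shows "(orbit m i :: 'a::field mpol set) = (\<lambda>A. lin_subst (2*m) A i) ` sylow_Sp m"
proof -
  interpret ring "ring_mat TYPE('a) (2*m) ()" by (rule ring_mat)
  let ?inv = "\<lambda>g :: 'a mat. inv\<^bsub>ring_mat TYPE('a) (2*m) ()\<^esub> g"
  have "?inv ` sylow_Sp m = (sylow_Sp m :: 'a mat set)"
  proof (intro subset_antisym subsetI)
    fix A :: "'a mat" assume A: "A \<in> sylow_Sp m"
    then have "?inv (?inv A) = A" using sylow_Sp_subset Units_inv_inv by blast
    then show "A \<in> ?inv ` sylow_Sp m" using sylow_Sp_inv[OF m A] by (metis image_eqI)
  qed (use sylow_Sp_inv[OF m] in blast)
  then have "(\<lambda>A. lin_subst (2*m) A i) ` sylow_Sp m = (\<lambda>A. lin_subst (2*m) A i) ` ?inv ` (sylow_Sp m :: 'a mat set)"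
    by simp
  then show ?thesis by (simp add: orbit_def act_def image_image)
qed

text \<open>Only row \<open>i\<close> of the matrix enters, with a one on the diagonal and zeros
  after it. This bounds the degree of the orbit polynomial.\<close>

lemma orbit_subset:
  assumes m: "m \<ge> 1" and i: "i < 2*m"
  shows "orbit m (Suc i) \<subseteq> {Var (Suc i) + (\<Sum>a<i. Const (w a) * Var (Suc a)) |w. True}"
proof
  fix y :: "'a mpol" assume "y \<in> orbit m (Suc i)"
  then obtain A where A: "A \<in> sylow_Sp m" "y = (\<Sum>a<2*m. Const (A $$ (i, a)) * Var (Suc a))"
    unfolding orbit_eq[OF m] using lin_subst_Suc[OF i] by auto
  have "y = (\<Sum>a<Suc i. Const (A $$ (i, a)) * Var (Suc a))"
    unfolding A(2) using A(1) i
    by (intro sum.mono_neutral_right) (auto simp: sylow_Sp_def lower_unitriangular_def)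
  then show "y \<in> {Var (Suc i) + (\<Sum>a<i. Const (w a) * Var (Suc a)) |w. True}"
    using A(1) i by (auto simp: sylow_Sp_def lower_unitriangular_def add.commute)
qed

text \<open>Only the values of \<open>w\<close> below \<open>k\<close> matter; restricted to
  \<open>{..<k}\<close> there are \<open>q ^ k\<close> choices, told apart by
  \<open>linear_form_inj\<close>.\<close>

lemma linear_forms_card:
  fixes u :: "'a::{field,finite} mpol" and k :: nat
  assumes q: "q = card (UNIV :: 'a set)"
  defines "V \<equiv> {u + (\<Sum>a<k. Const (w a) * Var (Suc a)) |w. True}"
  shows "finite V" "card V = q ^ k"
proof -
  let ?f = "\<lambda>w. u + (\<Sum>a<k. Const (w a) * Var (Suc a))" and ?E = "{..<k} \<rightarrow>\<^sub>E (UNIV :: 'a set)"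
  have "V = ?f ` ?E"
  proof
    show "V \<subseteq> ?f ` ?E"
    proof
      fix y assume "y \<in> V"
      then obtain w where "y = ?f w" by (auto simp: V_def)
      then have "y = ?f (restrict w {..<k})" by simp
      then show "y \<in> ?f ` ?E"
        by (rule image_eqI[where x = "restrict w {..<k}"]) (simp add: PiE_def)
    qed
  qed (auto simp: V_def)
  moreover have "inj_on ?f ?E"
    by (intro inj_onI PiE_ext) (auto dest: linear_form_inj)
  moreover have "finite ?E" by (intro finite_PiE) auto
  ultimately show "finite V" "card V = q ^ k"
    by (simp_all add: card_image card_PiE q)
qed

lemma finite_orbit:
  fixes i m :: nat
  assumes "m \<ge> 1" "i < 2*m"
  shows "finite (orbit m (Suc i) :: 'a::{field,finite} mpol set)"
  using orbit_subset[OF assms] linear_forms_card(1)[OF refl] by (rule finite_subset)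

text \<open>The group element maps the finite orbit injectively into itself, so it only permutes the
  factors.\<close>

lemma act_orbit_prod:
  fixes g :: "'a::{field,finite} mat"
  assumes m: "m \<ge> 1" and g: "g \<in> sylow_Sp m" and i: "i < 2*m"
  shows "act (2*m) g (orbit_prod (2*m) (sylow_Sp m) (Suc i)) = orbit_prod (2*m) (sylow_Sp m) (Suc i)"
proof -
  let ?O = "orbit m (Suc i) :: 'a mpol set"
  let ?g' = "inv\<^bsub>ring_mat TYPE('a) (2*m) ()\<^esub> g"
  have gU: "g \<in> GL (2*m)" using g sylow_Sp_subset by blast
  have g': "?g' \<in> sylow_Sp m" by (rule sylow_Sp_inv[OF m g])
  have inj: "inj_on (act (2*m) g) ?O"
    using act_inj[OF gU] by (auto intro: inj_onI)
  have "act (2*m) g ` ?O \<subseteq> ?O"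
  proof
    fix y assume "y \<in> act (2*m) g ` ?O"
    then obtain A where A: "A \<in> sylow_Sp m" "y = act (2*m) g (lin_subst (2*m) A (Suc i))"
      unfolding orbit_eq[OF m] by blast
    have "y = subst (lin_subst (2*m) ?g') (subst (lin_subst (2*m) A) (Var (Suc i)))"
      by (simp add: A(2) act_def)
    also have "\<dots> = lin_subst (2*m) (A * ?g') (Suc i)"
      using A(1) g' by (subst subst_lin_subst) (auto simp: sylow_Sp_def lower_unitriangular_def)
    finally show "y \<in> ?O"
      unfolding orbit_eq[OF m] using sylow_Sp_mult[OF m A(1) g'] by blast
  qed
  then have surj: "act (2*m) g ` ?O = ?O"
    by (rule endo_inj_surj[OF finite_orbit[OF m i] _ inj])
  have "act (2*m) g (\<Prod>y\<in>?O. y) = (\<Prod>y\<in>act (2*m) g ` ?O. y)"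
    by (simp add: act_prod prod.reindex[OF inj])
  then show ?thesis unfolding surj unfolding orbit_prod_def orbit_def .
qed

text \<open>The action substitutes the inverse matrix, so \<open>g\<close> is the inverse of the
  matrix from \<open>sylow_Sp_stabilizer\<close>.\<close>

lemma stabilizer_element:
  fixes w :: "nat \<Rightarrow> 'a::field"
  assumes m: "m \<ge> 1" and i: "i < 2*m"
  obtains g where "g \<in> sylow_Sp m" "\<And>r. r < i \<Longrightarrow> act (2*m) g (Var (Suc r)) = Var (Suc r)"
    "act (2*m) g (Var (Suc i)) = Var (Suc i) + (\<Sum>a<min i (2*m-i). Const (w a) * Var (Suc a))"
proof -
  interpret ring "ring_mat TYPE('a) (2*m) ()" by (rule ring_mat)
  let ?inv = "\<lambda>g :: 'a mat. inv\<^bsub>ring_mat TYPE('a) (2*m) ()\<^esub> g"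
  obtain A where A: "A \<in> sylow_Sp m"
    "\<And>r c. r < i \<Longrightarrow> c < 2*m \<Longrightarrow> A $$ (r, c) = (if r = c then 1 else 0)"
    "\<And>c. c < 2*m \<Longrightarrow> A $$ (i, c) = (if i = c then 1 else if c < min i (2*m-i) then w c else 0)"
    using sylow_Sp_stabilizer[OF m i, of w] by blast
  have inv: "?inv (?inv A) = A" using A(1) sylow_Sp_subset Units_inv_inv by blast
  have act: "act (2*m) (?inv A) (Var (Suc r)) = (\<Sum>c<2*m. Const (A $$ (r, c)) * Var (Suc c))"
    if "r < 2*m" for r
    using that by (simp add: act_def inv lin_subst_Suc)
  show ?thesis
  proof (rule that[of "?inv A"])
    show "?inv A \<in> sylow_Sp m" by (rule sylow_Sp_inv[OF m A(1)])
    show "act (2*m) (?inv A) (Var (Suc r)) = Var (Suc r)" if "r < i" for r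
    proof -
      have "act (2*m) (?inv A) (Var (Suc r)) = (\<Sum>c<2*m. if c = r then Var (Suc r) else 0)"
        using that i A(2) unfolding act[OF less_trans[OF that i]] by (intro sum.cong) auto
      then show ?thesis using that i by simp
    qed
    have "act (2*m) (?inv A) (Var (Suc i)) = (\<Sum>c<2*m. (if c = i then Var (Suc i) else 0)
        + (if c \<in> {..<min i (2*m-i)} then Const (w c) * Var (Suc c) else 0))"
      unfolding act[OF i] using A(3) by (intro sum.cong) auto
    also have "\<dots> = Var (Suc i) + (\<Sum>c\<in>{..<2*m} \<inter> {..<min i (2*m-i)}. Const (w c) * Var (Suc c))"
      using i by (simp add: sum.distrib sum.inter_restrict)
    also have "{..<2*m} \<inter> {..<min i (2*m-i)} = {..<min i (2*m-i)}" using i by auto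
    finally show "act (2*m) (?inv A) (Var (Suc i)) =
      Var (Suc i) + (\<Sum>a<min i (2*m-i). Const (w a) * Var (Suc a))" .
  qed
qed

section \<open>The tower of fields\<close>

definition gens :: "nat \<Rightarrow> nat \<Rightarrow> 'a::field mpol set" where
  "gens m q = orbit_prod (2*m) (sylow_Sp m) ` {1..m+1} \<union> h_poly m q ` {1..m-1}"

text \<open>Here \<open>i\<close> counts the variables already adjoined: \<open>i = 0\<close> is the
  field of the generators, and \<open>i = 2*m\<close> contains all of
  \<open>rat_field (2*m)\<close>.\<close>

definition tower :: "nat \<Rightarrow> nat \<Rightarrow> nat \<Rightarrow> 'a::field mpol fract set" where
  "tower m q i = adjoin (to_fract ` (gens m q \<union> (\<lambda>r. Var (Suc r)) ` {..<i}))"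

lemma type_subfield_tower: "type_subfield (tower m q i)"
  unfolding tower_def by (rule type_subfield_adjoin)

lemma Const_tower: "to_fract (Const c) \<in> tower m q i"
  unfolding tower_def by (rule adjoin_Const)

lemma gens_tower: "f \<in> gens m q \<Longrightarrow> to_fract f \<in> tower m q i"
  unfolding tower_def by (rule adjoin_incl) blast

lemma Var_tower: "r < i \<Longrightarrow> to_fract (Var (Suc r)) \<in> tower m q i"
  unfolding tower_def by (rule adjoin_incl) blast

lemma act_gens:
  fixes g :: "'a::{field,finite} mat"
  assumes q: "q = card (UNIV :: 'a set)" and m: "m \<ge> 1" and g: "g \<in> sylow_Sp m" and f: "f \<in> gens m q"
  shows "act (2*m) g f = f"
proof -
  consider i where "i \<in> {1..m+1}" "f = orbit_prod (2*m) (sylow_Sp m) i" | k where "f = h_poly m q k"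
    using f by (auto simp: gens_def)
  then show ?thesis
  proof cases
    case 1
    then obtain j where "i = Suc j" "j < 2*m" using m by (cases i) auto
    then show ?thesis using 1(2) act_orbit_prod[OF m g] by simp
  qed (simp add: act_h_poly[OF q m g])
qed

text \<open>One step down the tower. The stabilizer of the first \<open>i\<close> variables moves
  the next one to \<open>q ^ min i (2*m-i)\<close> places, at least the degree of \<open>p\<close>,
  so \<open>fixed_element_descent\<close> applies.\<close>

lemma tower_descent:
  fixes r :: "'a::{field,finite} mpol fract"
  assumes q: "q = card (UNIV :: 'a set)" and m: "m \<ge> 1" and i: "i < 2*m"
    and p: "p \<in> type_subfield.polys (tower m q i :: 'a mpol fract set)" "p \<noteq> 0"
      "poly p (to_fract (Var (Suc i))) = 0" "Polynomial.degree p \<le> q ^ min i (2*m-i)"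
    and r: "r \<in> tower m q (Suc i)" "r \<in> invariant_field (2*m) (sylow_Sp m)"
  shows "r \<in> tower m q i"
proof -
  interpret type_subfield "tower m q i :: 'a mpol fract set" by (rule type_subfield_tower)
  let ?x = "to_fract (Var (Suc i)) :: 'a mpol fract" and ?k = "min i (2*m-i)"
  let ?V = "{Var (Suc i) + (\<Sum>a<?k. Const (w a) * Var (Suc a)) |w. True} :: 'a mpol set"
  let ?E = "{poly a ?x / poly b ?x |a b. a \<in> polys \<and> b \<in> polys \<and> poly b ?x \<noteq> 0}"
  have V: "finite ?V" "card ?V = q ^ ?k" by (rule linear_forms_card[OF q])+
  show ?thesis
  proof (rule fixed_element_descent[OF p(1,2,3)])
    show "finite (to_fract ` ?V)" using V(1) by simp
    have "card (to_fract ` ?V) = card ?V" by (rule card_image) (simp add: inj_on_def)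
    then show "Polynomial.degree p \<le> card (to_fract ` ?V)" using V(2) p(4) by simp
    have K: "c \<in> ?E" if "c \<in> tower m q i" for c
      using that by (intro CollectI exI[of _ "[:c:]"] exI[of _ 1]) auto
    \<comment> \<open>Each generator of the next field lies in the present one or is
      \<open>?x\<close>, so minimality of \<open>adjoin\<close> suffices.\<close>
    have "tower m q (Suc i) \<subseteq> ?E"
      unfolding tower_def[of m q "Suc i"]
    proof (rule adjoin_least[OF simple_extension])
      show "range (\<lambda>c. to_fract (Const c)) \<subseteq> ?E" using K Const_tower by blast
      have x: "?x \<in> ?E"
        by (intro CollectI exI[of _ "[:0, 1:]"] exI[of _ 1]) auto
      show "to_fract ` (gens m q \<union> (\<lambda>r. Var (Suc r)) ` {..<Suc i}) \<subseteq> ?E"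
      proof
        fix y :: "'a mpol fract" assume "y \<in> to_fract ` (gens m q \<union> (\<lambda>r. Var (Suc r)) ` {..<Suc i})"
        then have "y \<in> tower m q i \<or> y = ?x"
          by (auto simp: less_Suc_eq intro: gens_tower Var_tower)
        then show "y \<in> ?E" using K x by blast
      qed
    qed
    then show "r \<in> ?E" using r(1) by blast
    fix s assume "s \<in> to_fract ` ?V"
    then obtain w where s: "s = to_fract (Var (Suc i) + (\<Sum>a<?k. Const (w a) * Var (Suc a)))"
      by blast
    obtain g where g: "g \<in> sylow_Sp m" "\<And>r. r < i \<Longrightarrow> act (2*m) g (Var (Suc r)) = Var (Suc r)"
      "act (2*m) g (Var (Suc i)) = Var (Suc i) + (\<Sum>a<?k. Const (w a) * Var (Suc a))"
      using stabilizer_element[OF m i, of w] by blast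
    have gU: "g \<in> GL (2*m)" using g(1) sylow_Sp_subset by blast
    have "act_fract (2*m) g c = c" if "c \<in> tower m q i" for c
      by (rule adjoin_fixed[OF gU _ that[unfolded tower_def]]) (use act_gens[OF q m g(1)] g(2) in auto)
    moreover have "act_fract (2*m) g r = r" using r(2) g(1) by (simp add: invariant_field_def)
    moreover have "act_fract (2*m) g ?x = s" by (simp add: act_fract_to_fract[OF gU] g(3) s)
    ultimately show "\<exists>\<sigma>. (\<forall>u v. \<sigma> (u + v) = \<sigma> u + \<sigma> v) \<and> (\<forall>u v. \<sigma> (u * v) = \<sigma> u * \<sigma> v)
        \<and> (\<forall>c\<in>tower m q i. \<sigma> c = c) \<and> \<sigma> r = r \<and> \<sigma> ?x = s"
      by (intro exI[of _ "act_fract (2*m) g"]) (auto simp: act_fract_add[OF gU] act_fract_mult[OF gU])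
  qed
qed

lemma degree_prod_linear:
  "finite A \<Longrightarrow> Polynomial.degree (\<Prod>y\<in>A. [:c y, 1 :: 'l::field:]) = card A"
proof (induction A rule: finite_induct)
  case (insert y A)
  have "(\<Prod>y\<in>A. [:c y, 1:]) \<noteq> (0 :: 'l poly)" using insert(1) by simp
  then have "Polynomial.degree ([:c y, 1:] * (\<Prod>y\<in>A. [:c y, 1:])) = Suc (card A)"
    using insert.IH by (subst degree_mult_eq) auto
  then show ?case unfolding prod.insert[OF insert.hyps] card_insert_disjoint[OF insert.hyps] .
qed simp

text \<open>Each \<open>y\<close> in the orbit of \<open>x = Var (Suc i)\<close> differs from
  \<open>x\<close> by a linear form in the earlier variables. So the product of all
  \<open>T + (y - x)\<close> has coefficients in the tower field, and at \<open>T = x\<close> it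
  takes the value \<open>N(x)\<close>, a generator as \<open>i \<le> m\<close>.\<close>

lemma tower_poly_first:
  assumes q: "q = card (UNIV :: 'a::{field,finite} set)" and m: "m \<ge> 1" and i: "i \<le> m"
  obtains p where "p \<in> type_subfield.polys (tower m q i :: 'a mpol fract set)" "p \<noteq> 0"
    "poly p (to_fract (Var (Suc i))) = 0" "Polynomial.degree p \<le> q ^ min i (2*m-i)"
proof -
  interpret type_subfield "tower m q i :: 'a mpol fract set" by (rule type_subfield_tower)
  have i2: "i < 2*m" using i m by simp
  let ?O = "orbit m (Suc i) :: 'a mpol set" and ?x = "to_fract (Var (Suc i)) :: 'a mpol fract"
  let ?V = "{Var (Suc i) + (\<Sum>a<i. Const (w a) * Var (Suc a)) |w. True} :: 'a mpol set"
  define P where "P = (\<Prod>y\<in>?O. [:to_fract (y - Var (Suc i)), 1:])"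
  define N where "N = to_fract (\<Prod>y\<in>?O. y)"
  have O: "finite ?O" "?O \<subseteq> ?V" using finite_orbit[OF m i2] orbit_subset[OF m i2] by auto
  \<comment> \<open>The identity makes the orbit nonempty, so \<open>P\<close> has positive degree
    and differs from the constant \<open>N\<close>.\<close>
  have "1\<^sub>m (2*m) \<in> (sylow_Sp m :: 'a mat set)"
    by (auto simp: sylow_Sp_def lower_unitriangular_def symp_form_eq[OF m])
  then have "?O \<noteq> {}" unfolding orbit_def by blast
  then have card: "card ?O > 0" using O(1) by (simp add: card_gt_0_iff)
  have deg: "Polynomial.degree P = card ?O" unfolding P_def by (rule degree_prod_linear[OF O(1)])
  show ?thesis
  proof (rule that[of "P - [:N:]"])
    have "Suc i \<in> {1..m+1}" using i by simp
    then have "orbit_prod (2*m) (sylow_Sp m) (Suc i) \<in> gens m q" unfolding gens_def by blast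
    then have "N \<in> tower m q i"
      unfolding N_def orbit_def orbit_prod_def by (rule gens_tower)
    moreover have "to_fract (y - Var (Suc i)) \<in> tower m q i" if y: "y \<in> ?O" for y
    proof -
      obtain w where "y = Var (Suc i) + (\<Sum>a<i. Const (w a) * Var (Suc a))"
        using y O(2) by blast
      then have "to_fract (y - Var (Suc i)) = (\<Sum>a<i. to_fract (Const (w a)) * to_fract (Var (Suc a)))"
        by simp
      also have "\<dots> \<in> tower m q i" by (intro sum mult Const_tower Var_tower) simp
      finally show ?thesis .
    qed
    ultimately show "P - [:N:] \<in> polys"
      unfolding P_def by (intro polys_diff polys_prod polys_pCons polys_0 one) auto
    have "P \<noteq> [:N:]" using deg card by auto
    then show "P - [:N:] \<noteq> 0" by simp
    show "poly (P - [:N:]) ?x = 0"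
      by (simp add: P_def N_def poly_prod to_fract_prod)
    have "card ?O \<le> card ?V" using O(2) linear_forms_card(1)[OF q] by (intro card_mono)
    then have "card ?O \<le> q ^ min i (2*m-i)" using linear_forms_card(2)[OF q, of _ i] i by (simp add: min_def)
    moreover have "Polynomial.degree (P - [:N:]) \<le> card ?O"
      using deg by (intro degree_diff_le) auto
    ultimately show "Polynomial.degree (P - [:N:]) \<le> q ^ min i (2*m-i)" by simp
  qed
qed

lemma card_field_ge_2: "card (UNIV :: 'a::{field,finite} set) \<ge> 2"
proof -
  have "card {0, 1 :: 'a} \<le> card (UNIV :: 'a set)" by (rule card_mono) auto
  then show ?thesis by simp
qed

text \<open>As \<open>q \<ge> 2\<close>, the exponents \<open>q ^ a\<close> increase strictly, so
  the term with \<open>a = n\<close> leads.\<close>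

lemma additive_poly:
  fixes l :: "nat \<Rightarrow> 'l::field"
  assumes q: "q \<ge> 2" and l: "l n = 1"
  defines "P \<equiv> (\<Sum>a\<le>n. Polynomial.monom (l a) (q ^ a))"
  shows "poly P t = (\<Sum>a\<le>n. l a * t ^ q ^ a)" "Polynomial.degree P = q ^ n"
    "Polynomial.lead_coeff P = 1"
proof -
  show "poly P t = (\<Sum>a\<le>n. l a * t ^ q ^ a)"
    by (simp add: P_def poly_sum poly_monom)
  have "Polynomial.coeff P (q ^ n) = (\<Sum>a\<le>n. if a = n then l n else 0)"
    unfolding P_def coeff_sum using q by (intro sum.cong) auto
  then have coeff: "Polynomial.coeff P (q ^ n) = 1" using l by simp
  have "Polynomial.degree P \<le> q ^ n"
    unfolding P_def
  proof (rule degree_sum_le)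
    fix a assume "a \<in> {..n}"
    then have "q ^ a \<le> q ^ n" using q by (intro power_increasing) auto
    then show "Polynomial.degree (Polynomial.monom (l a) (q ^ a)) \<le> q ^ n"
      using degree_monom_le order_trans by blast
  qed simp
  then show deg: "Polynomial.degree P = q ^ n"
    using coeff le_degree[of P "q ^ n"] by simp
  show "Polynomial.lead_coeff P = 1" using coeff by (simp add: deg)
qed

text \<open>An additive polynomial is linear over the base field. If it also killed
  \<open>Var (Suc n)\<close>, it would vanish on the span of \<open>n + 1\<close> variables:
  \<open>q ^ Suc n\<close> roots for degree \<open>q ^ n\<close>.\<close>

lemma additive_poly_nonzero:
  assumes q: "q = card (UNIV :: 'a::{field,finite} set)"
    and l: "l n = 1" "\<And>j. j < n \<Longrightarrow> (\<Sum>a\<le>n. l a * to_fract (Var (Suc j)) ^ q ^ a) = 0"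
  shows "(\<Sum>a\<le>n. l a * to_fract (Var (Suc n)) ^ q ^ a) \<noteq> (0 :: 'a mpol fract)"
proof
  define P where "P = (\<Sum>a\<le>n. Polynomial.monom (l a) (q ^ a))"
  assume 0: "(\<Sum>a\<le>n. l a * to_fract (Var (Suc n)) ^ q ^ a) = (0 :: 'a mpol fract)"
  have q2: "q \<ge> 2" unfolding q by (rule card_field_ge_2)
  note P = additive_poly[of q l n, OF q2 l(1), folded P_def]
  let ?V = "{0 + (\<Sum>a<Suc n. Const (w a) * Var (Suc a)) |w. True} :: 'a mpol set"
  have V: "finite ?V" "card ?V = q ^ Suc n" by (rule linear_forms_card[OF q])+
  have "P \<noteq> 0" using P(3) by auto
  have "to_fract ` ?V \<subseteq> {t. poly P t = 0}"
  proof
    fix t assume "t \<in> to_fract ` ?V"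
    then obtain w where t: "t = to_fract (\<Sum>j<Suc n. Const (w j) * Var (Suc j))" by auto
    have "t ^ q ^ a = (\<Sum>j<Suc n. to_fract (Const (w j)) * to_fract (Var (Suc j)) ^ q ^ a)" for a
      by (simp only: t to_fract_sum to_fract_mult power_q_sum[OF q] power_mult_distrib
          to_fract_power[symmetric] Const_power_q[OF q])
    then have "poly P t = (\<Sum>a\<le>n. \<Sum>j<Suc n. to_fract (Const (w j)) * (l a * to_fract (Var (Suc j)) ^ q ^ a))"
      by (simp only: P(1) sum_distrib_left mult.left_commute)
    also have "\<dots> = (\<Sum>j<Suc n. to_fract (Const (w j)) * (\<Sum>a\<le>n. l a * to_fract (Var (Suc j)) ^ q ^ a))"
      unfolding sum_distrib_left by (rule sum.swap)
    also have "\<dots> = 0"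
      using l(2) 0 by (intro sum.neutral) (auto simp: less_Suc_eq)
    finally show "t \<in> {t. poly P t = 0}" by simp
  qed
  then have "card (to_fract ` ?V) \<le> card {t. poly P t = 0}"
    by (intro card_mono poly_roots_finite \<open>P \<noteq> 0\<close>)
  moreover have "card (to_fract ` ?V) = card ?V" by (rule card_image) (simp add: inj_on_def)
  ultimately have "q ^ Suc n \<le> q ^ n"
    using card_poly_roots_bound[OF \<open>P \<noteq> 0\<close>] unfolding V(2) P(2) by linarith
  then show False using q2 by simp
qed

lemma to_fract_h_poly:
  "to_fract (h_poly m q k) =
    (\<Sum>s<m. to_fract (Var (Suc s)) * to_fract (Var (Suc (2*m-1-s))) ^ q ^ k
      - to_fract (Var (Suc (2*m-1-s))) * to_fract (Var (Suc s)) ^ q ^ k)"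
  unfolding h_poly_eq by (simp add: to_fract_power mult.commute)

text \<open>
  With \<open>P(T) = \<Sum> \<lambda>\<^sub>a T ^ q ^ a\<close> of degree \<open>q ^ (n-1)\<close> killing \<open>x\<^sub>1, \<dots>, x\<^sub>n\<^sub>-\<^sub>1\<close> and \<open>y\<^sub>s\<close> the variable paired
  with \<open>x\<^sub>s\<close>, the sum of all \<open>P(x\<^sub>s) P(y\<^sub>s)\<^sup>q - P(y\<^sub>s) P(x\<^sub>s)\<^sup>q\<close> is a combination of Frobenius powers of the
  \<open>h\<^sub>k\<close>, \<open>k \<le> n\<close>. Its terms with \<open>s < n\<close> vanish, and those with \<open>s > n\<close> lie in the field reached so
  far; this leaves an equation of degree \<open>q ^ n\<close> for \<open>y\<^sub>n\<close>.
  In the proof these indices start at 0, so that its \<open>n\<close> is one less.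
\<close>

lemma tower_poly_last:
  assumes q: "q = card (UNIV :: 'a::{field,finite} set)" and m: "m \<ge> 1" and i: "m < i" "i < 2*m"
  obtains p where "p \<in> type_subfield.polys (tower m q i :: 'a mpol fract set)" "p \<noteq> 0"
    "poly p (to_fract (Var (Suc i))) = 0" "Polynomial.degree p \<le> q ^ min i (2*m-i)"
proof -
  interpret type_subfield "tower m q i :: 'a mpol fract set" by (rule type_subfield_tower)
  let ?K = "tower m q i :: 'a mpol fract set"
  \<comment> \<open>With this choice \<open>y n\<close> is the variable about to be adjoined, and
    \<open>x n\<close> is its partner.\<close>
  define n where "n = 2*m - i - 1"
  have n: "i = 2*m-1-n" "Suc n < m" "2*m - i = Suc n" using i by (auto simp: n_def)
  define x :: "nat \<Rightarrow> 'a mpol fract" where "x s = to_fract (Var (Suc s))" for s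
  define y :: "nat \<Rightarrow> 'a mpol fract" where "y s = to_fract (Var (Suc (2*m-1-s)))" for s
  have xK: "x s \<in> ?K" if "s < i" for s unfolding x_def by (rule Var_tower[OF that])
  have yK: "y s \<in> ?K" if "n < s" "s < m" for s
    unfolding y_def using that n i by (intro Var_tower) auto
  have q2: "q \<ge> 2" unfolding q by (rule card_field_ge_2)
  \<comment> \<open>\<open>additive_poly_kernel\<close> counts its elements from 1, hence
    \<open>x (j - 1)\<close>.\<close>
  have "\<exists>l. (\<forall>a. l a \<in> ?K) \<and> l n = 1 \<and> (\<forall>j\<in>{1..n}. (\<Sum>a\<le>n. l a * x (j - 1) ^ q ^ a) = 0)"
    using q2 n i by (intro additive_poly_kernel power_q_add[OF q] xK) auto
  then obtain l where l: "\<And>a. l a \<in> ?K" "l n = 1"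
      "\<And>j. j \<in> {1..n} \<Longrightarrow> (\<Sum>a\<le>n. l a * x (j - 1) ^ q ^ a) = 0"
    by blast
  define P where "P t = (\<Sum>a\<le>n. l a * t ^ q ^ a)" for t
  have P0: "P (x s) = 0" if "s < n" for s
    using l(3)[of "Suc s"] that by (simp add: P_def)
  have Pn: "P (x n) \<noteq> 0"
    unfolding P_def x_def using l(2) P0 by (intro additive_poly_nonzero[OF q]) (auto simp: P_def x_def)
  have PK: "P t \<in> ?K" if "t \<in> ?K" for t
    unfolding P_def using that l(1) by (intro sum mult power)
  have Pq: "P t ^ q = (\<Sum>b\<le>n. l b ^ q * t ^ q ^ Suc b)" for t
    using power_q_sum[OF q, of "\<lambda>a. l a * t ^ q ^ a" "{..n}" 1]
    by (simp add: P_def power_mult_distrib power_mult[symmetric] mult.commute)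
  define D where "D s = P (x s) * P (y s) ^ q - P (y s) * P (x s) ^ q" for s
  \<comment> \<open>\<open>H 0 k\<close> is the polynomial \<open>h_poly m q k\<close>, and
    \<open>H a (a + k)\<close> is its \<open>q ^ a\<close>-th power.\<close>
  define H where "H a b = (\<Sum>s<m. x s ^ q ^ a * y s ^ q ^ b - y s ^ q ^ a * x s ^ q ^ b)" for a b
  have H0: "H 0 k ^ q ^ a = H a (a + k)" for a k
    unfolding H_def by (simp add: power_q_sum[OF q] power_q_diff[OF q] power_mult_distrib
        power_mult[symmetric] power_add mult.commute)
  have H1: "H 0 k \<in> ?K" if "k \<in> {1..m-1}" for k
  proof -
    have "H 0 k = to_fract (h_poly m q k)"
      by (simp add: H_def to_fract_h_poly x_def y_def)
    also have "\<dots> \<in> ?K" using that by (intro gens_tower) (auto simp: gens_def)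
    finally show ?thesis .
  qed
  have H_anti: "H a b = - H b a" for a b
    by (simp add: H_def algebra_simps flip: sum_negf)
  have H2: "H a b \<in> ?K" if "a \<le> b" "b - a \<le> m - 1" for a b
  proof (cases "a = b")
    case True
    then show ?thesis by (simp add: H_def mult.commute)
  next
    case False
    then have "H 0 (b - a) ^ q ^ a \<in> ?K" using that by (intro power H1) auto
    then show ?thesis using that by (simp add: H0)
  qed
  \<comment> \<open>The indices differ by at most \<open>n + 1 \<le> m - 1\<close>, so only
    generators among the \<open>h_poly m q k\<close> occur; antisymmetry handles
    \<open>a > Suc b\<close>.\<close>
  have H: "H a (Suc b) \<in> ?K" if "a \<le> n" "b \<le> n" for a b
  proof (cases "a \<le> Suc b")
    case True
    then show ?thesis using that n by (intro H2) auto
  next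
    case False
    then have "H (Suc b) a \<in> ?K" using that n by (intro H2) auto
    then show ?thesis using H_anti[of a "Suc b"] by auto
  qed
  have "(\<Sum>s<m. D s) = (\<Sum>s<m. \<Sum>a\<le>n. \<Sum>b\<le>n.
      l a * l b ^ q * (x s ^ q ^ a * y s ^ q ^ Suc b - y s ^ q ^ a * x s ^ q ^ Suc b))"
  proof (rule sum.cong[OF refl])
    fix s
    have *: "P u * P v ^ q = (\<Sum>a\<le>n. \<Sum>b\<le>n. l a * l b ^ q * (u ^ q ^ a * v ^ q ^ Suc b))" for u v
      unfolding Pq unfolding P_def sum_product by (simp only: mult_ac)
    show "D s = (\<Sum>a\<le>n. \<Sum>b\<le>n.
      l a * l b ^ q * (x s ^ q ^ a * y s ^ q ^ Suc b - y s ^ q ^ a * x s ^ q ^ Suc b))"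
      unfolding D_def * right_diff_distrib sum_subtractf ..
  qed
  also have "\<dots> = (\<Sum>a\<le>n. \<Sum>b\<le>n. l a * l b ^ q * H a (Suc b))"
    unfolding H_def sum_distrib_left by (rule trans[OF sum.swap sum.cong[OF refl sum.swap]])
  also have "\<dots> \<in> ?K" using l(1) H by (intro sum mult power) auto
  finally have DK: "(\<Sum>s<m. D s) \<in> ?K" .
  have D0: "D s = 0" if "s < n" for s
    using q2 by (simp add: D_def P0[OF that] zero_power)
  \<comment> \<open>Terms below \<open>n\<close> vanish, and for \<open>s > n\<close> both
    \<open>x s\<close> and \<open>y s\<close> are already adjoined; this isolates
    \<open>D n\<close>.\<close>
  have "(\<Sum>s<m. D s) = (\<Sum>s\<in>{n} \<union> {Suc n..<m}. D s)"
  proof (rule sum.mono_neutral_right)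
    show "\<forall>s\<in>{..<m} - ({n} \<union> {Suc n..<m}). D s = 0"
    proof
      fix s assume "s \<in> {..<m} - ({n} \<union> {Suc n..<m})"
      then have "s < n" by auto
      then show "D s = 0" by (rule D0)
    qed
  qed (use n in auto)
  also have "\<dots> = D n + (\<Sum>s=Suc n..<m. D s)"
    by (subst sum.union_disjoint) auto
  finally have Dn: "D n = (\<Sum>s<m. D s) - (\<Sum>s=Suc n..<m. D s)" by simp
  have "D s \<in> ?K" if "s \<in> {Suc n..<m}" for s
    unfolding D_def using that xK[of s] yK[of s] i by (intro diff mult power PK) auto
  then have DnK: "D n \<in> ?K" unfolding Dn by (intro diff DK sum)
  define Q where "Q = (\<Sum>a\<le>n. Polynomial.monom (l a) (q ^ a))"
  note Q = additive_poly[of q l n, OF q2 l(2), folded Q_def]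
  have poly_Q: "poly Q t = P t" for t
    by (simp only: Q(1) P_def)
  have QK: "Q \<in> polys" unfolding Q_def by (intro polys_sum polys_monom l(1))
  have less: "q ^ n < q ^ Suc n" using q2 by simp
  have "Q \<noteq> 0" using Q(3) by auto
  then have degQq: "Polynomial.degree (Q ^ q) = q ^ Suc n"
    using degree_power_eq[of Q q] by (simp add: Q(2))
  have coeffQq: "Polynomial.coeff (Q ^ q) (q ^ Suc n) = 1"
    using lead_coeff_power[of Q q] Q(3) unfolding degQq by simp
  \<comment> \<open>The expression for \<open>D n\<close> with \<open>y n\<close> replaced by the
    unknown, minus the value \<open>D n\<close>.\<close>
  define p where "p = Polynomial.smult (P (x n)) (Q ^ q) - Polynomial.smult (P (x n) ^ q) Q - [:D n:]"
  have PxK: "P (x n) \<in> ?K" using n i by (intro PK xK) auto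
  show ?thesis
  proof (rule that[of p])
    show "p \<in> polys" unfolding p_def
      by (intro polys_diff polys_smult polys_power power QK PxK polys_pCons DnK polys_0)
    have "q ^ Suc n \<noteq> 0" using q2 by simp
    \<comment> \<open>A successor as exponent lets the coefficient of the constant polynomial
      simplify to zero.\<close>
    then obtain d where d: "q ^ Suc n = Suc d" by (cases "q ^ Suc n") auto
    have "Polynomial.coeff Q (q ^ Suc n) = 0" "Polynomial.coeff [:D n:] (q ^ Suc n) = 0"
      using less coeff_eq_0[of Q "q ^ Suc n"] unfolding Q(2) by (simp_all add: d del: power_Suc)
    then have "Polynomial.coeff p (q ^ Suc n) = P (x n)"
      unfolding p_def coeff_diff coeff_smult coeffQq by simp
    then show "p \<noteq> 0" using Pn by auto
    have y: "to_fract (Var (Suc i)) = y n" by (simp add: y_def n(1))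
    show "poly p (to_fract (Var (Suc i))) = 0"
      unfolding y by (simp add: p_def poly_Q D_def mult.commute)
    have "Polynomial.degree p \<le> q ^ Suc n"
      unfolding p_def using less Q(2) degQq
      by (intro degree_diff_le order_trans[OF degree_smult_le]) auto
    moreover have "min i (2*m-i) = Suc n" using n i by simp
    ultimately show "Polynomial.degree p \<le> q ^ min i (2*m-i)" by simp
  qed
qed

lemma gens_invariant:
  assumes q: "q = card (UNIV :: 'a::{field,finite} set)" and m: "m \<ge> 1"
    and f: "f \<in> (gens m q :: 'a mpol set)"
  shows "to_fract f \<in> invariant_field (2*m) (sylow_Sp m)"
proof -
  interpret type_subfield "rat_field (2*m) :: 'a mpol fract set" by (rule type_subfield_rat_field)
  have X: "to_fract (Var (Suc r)) \<in> (rat_field (2*m) :: 'a mpol fract set)" if "r < 2*m" for r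
    using that by (intro to_fract_rat_field poly_ring_Var) auto
  have "to_fract f \<in> rat_field (2*m)"
  proof -
    consider i where "i \<in> {1..m+1}" "f = orbit_prod (2*m) (sylow_Sp m) i" | k where "f = h_poly m q k"
      using f by (auto simp: gens_def)
    then show ?thesis
    proof cases
      case 1
      then obtain j where j: "i = Suc j" "j < 2*m" using m by (cases i) auto
      have "to_fract y \<in> rat_field (2*m)" if y: "y \<in> orbit m (Suc j)" for y :: "'a mpol"
      proof -
        obtain w where "y = Var (Suc j) + (\<Sum>a<j. Const (w a) * Var (Suc a))"
          using y orbit_subset[OF m j(2)] by blast
        then have "to_fract y = to_fract (Var (Suc j)) + (\<Sum>a<j. to_fract (Const (w a)) * to_fract (Var (Suc a)))"
          by simp
        also have "\<dots> \<in> rat_field (2*m)"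
          using j(2) by (intro add sum mult X to_fract_rat_field[OF poly_ring_Const]) auto
        finally show ?thesis .
      qed
      then show ?thesis
        unfolding 1(2) orbit_prod_def to_fract_prod j(1) by (intro prod) (auto simp: orbit_def)
    next
      case 2
      then show ?thesis
        unfolding 2 to_fract_h_poly by (intro sum diff mult power X) auto
    qed
  qed
  moreover have "act_fract (2*m) g (to_fract f) = to_fract f" if "g \<in> sylow_Sp m" for g
    using that act_gens[OF q m that f] sylow_Sp_subset by (subst act_fract_to_fract) auto
  ultimately show ?thesis by (simp add: invariant_field_def)
qed

theorem theorem4p14:
  fixes m q :: nat
  assumes "m \<ge> 1" and "q = card (UNIV :: 'a::{field,finite} set)"
  shows "invariant_field (2*m) (sylow_Sp m :: 'a mat set) =
    adjoin (to_fract ` (orbit_prod (2*m) (sylow_Sp m) ` {1..m+1} \<union> h_poly m q ` {1..m-1}))"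
proof -
  let ?I = "invariant_field (2*m) (sylow_Sp m :: 'a mat set)"
  have "adjoin (to_fract ` gens m q) \<subseteq> ?I"
  proof (rule adjoin_least)
    show "type_subfield ?I" by (rule type_subfield_invariant_field[OF sylow_Sp_subset])
    show "range (\<lambda>c. to_fract (Const c)) \<subseteq> ?I"
      using sylow_Sp_subset[of m]
      by (auto simp: invariant_field_def act_Const act_fract_to_fract intro!: to_fract_rat_field poly_ring_Const)
    show "to_fract ` gens m q \<subseteq> ?I" using gens_invariant[OF assms(2,1)] by blast
  qed
  moreover have "?I \<subseteq> adjoin (to_fract ` gens m q)"
  proof
    fix r assume r: "r \<in> ?I"
    \<comment> \<open>Here \<open>k\<close> counts the steps down from the top field;
      \<open>k = 2*m\<close> reaches the field of the generators.\<close>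
    have "r \<in> tower m q (2*m - k)" if "k \<le> 2*m" for k
      using that
    proof (induction k)
      case 0
      have "(\<lambda>r. Var (Suc r)) ` {..<2*m} = (Var ` {1..2*m} :: 'a mpol set)"
        by (simp only: image_image flip: image_Suc_lessThan)
      then have "rat_field (2*m) \<subseteq> (tower m q (2*m) :: 'a mpol fract set)"
        unfolding tower_def by (intro rat_field_adjoin) auto
      then show ?case using r by (auto simp: invariant_field_def)
    next
      case (Suc k)
      define i where "i = 2*m - Suc k"
      have i: "i < 2*m" "2*m - k = Suc i" using Suc.prems by (auto simp: i_def)
      have "r \<in> tower m q (Suc i)" using Suc i by simp
      \<comment> \<open>The two kinds of equations cover \<open>i \<le> m\<close> and
        \<open>m < i\<close>.\<close>
      then have "r \<in> tower m q i"
        using tower_poly_first[OF assms(2,1), of i] tower_poly_last[OF assms(2,1), of i]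
          tower_descent[OF assms(2,1) i(1)] i r by (metis not_le)
      then show ?case by (simp add: i_def)
    qed
    from this[of "2*m"] show "r \<in> adjoin (to_fract ` gens m q)" by (simp add: tower_def)
  qed
  ultimately show ?thesis unfolding gens_def by blast
qed

end
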